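(* Let $X\subseteq\mathbb{R}^n$ be a nonempty (possibly unbounded) open set, let $m\in\mathbb{N}$, let $F$ be a real-valued function of $x\in X$ and of real variables $\xi_p$ ($p\in\mathbb{N}^n$, $|p|\le m$) that is jointly $\mathcal{C}^\infty$ in all its arguments, let $f\in\mathcal{C}^\infty(X)$, and consider the smooth nonlinear PDE $$T(x,D)U(x)=f(x),\quad x\in X,\qquad\text{where } T(x,D)U(x)=F\bigl(x,U(x),\ldots,D^pU(x),\ldots\bigr),\ |p|\le m.$$ Suppose that there is a dense subset $X_{sol}$ of $X$ such that $$0\in R^l_x\qquad\text{for all } l\in\mathbb{N},\ x\in X_{sol}.$$ Then there exist a subset $\Sigma\subset X$ with $X\setminus\Sigma$ dense in $X$ and $X\setminus\Sigma\subseteq X_{sol}$, and a generalized function $$U=s+\mathcal{J}_\Sigma(X)\in B_\Sigma(X),\qquad s\in(\mathcal{C}^\infty(X))^{\mathbb{N}},$$ which is a solution of the PDE in the differential algebra $B_\Sigma(X)$, that is, $$T(x,D)U=f\quad\text{in } B_\Sigma(X).$$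
   Context: $\mathbb{N}=\{0,1,2,\ldots\}$. All functions are real valued, and $\mathcal{C}^\infty(X)$ is the algebra of real-valued smooth functions on $X$. $(\mathcal{C}^\infty(X))^{\mathbb{N}}$ is the algebra of sequences of such functions with termwise operations. The ranges $R^l_x$: for $l\in\mathbb{N}$ put $$T^l(x,D)U(x)=\sum_{p\in\mathbb{N}^n,\,|p|\le l}\Bigl(D^p\bigl(T(x,D)U(x)-f(x)\bigr)\Bigr)^2 ,$$ a smooth nonlinear partial differential operator of order at most $m+l$. Carrying out the derivatives by the chain rule, it can be written as $T^l(x,D)U(x)=F^l\bigl(x,U(x),\ldots,D^rU(x),\ldots\bigr)$, $|r|\le m+l$, with $F^l$ smooth in $x\in X$ and in the real variables $\xi_r$ ($r\in\mathbb{N}^n$, $|r|\le m+l$). Then, for $x\in X$, $$R^l_x=\{\,F^l(x,(\xi_r)_{|r|\le m+l}) : \xi_r\in\mathbb{R},\ r\in\mathbb{N}^n,\ |r|\le m+l\,\}\subseteq\mathbb{R}.$$ The ideal and the algebra: for $\Sigma\subset X$ with $X\setminus\Sigma$ dense in $X$, $\mathcal{J}_\Sigma(X)$ is the ideal in $(\mathcal{C}^\infty(X))^{\mathbb{N}}$ of all sequences $w=(w_\nu)_{\nu\in\mathbb{N}}$ such that for every $x\in X\setminus\Sigma$ and $l\in\mathbb{N}$ there is $\nu\in\mathbb{N}$ such that $D^pw_\mu(x)=0$ for all $\mu\ge\nu$ and all $p\in\mathbb{N}^n$ with $|p|\le l$. The algebra of generalized functions is $B_\Sigma(X)=(\mathcal{C}^\infty(X))^{\mathbb{N}}/\mathcal{J}_\Sigma(X)$.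 A smooth function $\psi\in\mathcal{C}^\infty(X)$ is identified with the class of the constant sequence $(\psi,\psi,\psi,\ldots)$; this is an embedding of algebras. Action of $T(x,D)$ on $B_\Sigma(X)$: for $U=s+\mathcal{J}_\Sigma(X)$ with $s=(s_\nu)_{\nu\in\mathbb{N}}$, $T(x,D)U=t+\mathcal{J}_\Sigma(X)$, where $t=(t_\nu)_{\nu\in\mathbb{N}}$ and $t_\nu(x)=F(x,s_\nu(x),\ldots,D^ps_\nu(x),\ldots)$, $|p|\le m$, $x\in X$; this is well defined. Thus $T(x,D)U=f$ in $B_\Sigma(X)$ means that the class of $t$ equals the class of the constant sequence $(f,f,f,\ldots)$. *)

theory Defs
  imports "HOL-Analysis.Analysis" "HOL-Algebra.QuotRing"
begin

text \<open>
  Two kinds of real-valued functions are needed: functions of \<open>x\<close> in \<open>\<real>\<^sup>n\<close>, and functions of \<open>x\<close>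
  together with jet variables \<open>\<xi>\<^sub>p\<close> indexed by multi-indices \<open>p\<close>.  As the number of jet variables
  varies with the order, jets are functions on all multi-indices, which do not form a normed
  space.  Smoothness is therefore defined through iterated partial derivatives, for an arbitrary
  family \<open>mv d t a\<close> of translations of the point \<open>a\<close> by \<open>t\<close> in the coordinate direction \<open>d\<close>.
\<close>

definition partial_deriv ::
  "('d \<Rightarrow> real \<Rightarrow> 'a \<Rightarrow> 'a) \<Rightarrow> 'd \<Rightarrow> ('a \<Rightarrow> real) \<Rightarrow> 'a \<Rightarrow> real" where
  "partial_deriv mv d g a = deriv (\<lambda>t. g (mv d t a)) 0"

definition C_infinity ::
  "('d \<Rightarrow> real \<Rightarrow> 'a \<Rightarrow> 'a) \<Rightarrow> 'd set \<Rightarrow> 'a::topological_space set \<Rightarrow> ('a \<Rightarrow> real) \<Rightarrow> bool" where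
  "C_infinity mv D S g \<longleftrightarrow>
     (\<forall>ds\<in>lists D.
        continuous_on S (foldr (partial_deriv mv) ds g) \<and>
        (\<forall>d\<in>D. \<forall>a\<in>S. (\<lambda>t. foldr (partial_deriv mv) ds g (mv d t a)) differentiable (at 0)))"

definition mv_x :: "'n::finite \<Rightarrow> real \<Rightarrow> real^'n \<Rightarrow> real^'n" where
  "mv_x i t x = x + t *\<^sub>R axis i 1"

text \<open>Elements of \<open>C\<^sup>\<infinity>(X)\<close> are total functions of which only the values on \<open>X\<close> matter.\<close>

definition smooth_on :: "(real^'n::finite) set \<Rightarrow> (real^'n \<Rightarrow> real) \<Rightarrow> bool" where
  "smooth_on X u \<longleftrightarrow> C_infinity mv_x UNIV X u"

type_synonym 'n multi_index = "nat^'n"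

definition mi_order :: "'n::finite multi_index \<Rightarrow> nat" where
  "mi_order p = (\<Sum>i\<in>UNIV. p $ i)"

lemma finite_mi_order_le: "finite {p :: 'n::finite multi_index. mi_order p \<le> l}"
proof (rule finite_subset)
  have "p $ i \<le> l" if "mi_order p \<le> l" for p :: "'n multi_index" and i
    using member_le_sum[of i UNIV "\<lambda>i. p $ i"] that unfolding mi_order_def by simp
  then show "{p :: 'n multi_index. mi_order p \<le> l}
      \<subseteq> vec_lambda ` (UNIV \<rightarrow>\<^sub>E {..l})"
    by (force intro!: image_eqI[where x = "vec_nth _"] simp: PiE_def extensional_def)
qed (simp add: finite_PiE)

text \<open>
  The index type carries no order, so an enumeration of the coordinates is chosen once and for
  all; on smooth functions the operators \<open>D\<^sup>p\<close> below do not depend on this choice.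
\<close>

definition coords :: "'n::finite list" where
  "coords = (SOME is. set is = UNIV \<and> distinct is)"

lemma coords: "set (coords :: 'n::finite list) = UNIV" "distinct (coords :: 'n list)"
  using someI_ex[OF finite_distinct_list[OF finite_class.finite_UNIV]]
  unfolding coords_def by auto

definition multi_power :: "('n::finite \<Rightarrow> 'g \<Rightarrow> 'g) \<Rightarrow> 'n multi_index \<Rightarrow> 'g \<Rightarrow> 'g" where
  "multi_power \<delta> p = foldr (\<lambda>i. \<delta> i ^^ (p $ i)) coords"

definition D :: "'n::finite multi_index \<Rightarrow> (real^'n \<Rightarrow> real) \<Rightarrow> real^'n \<Rightarrow> real" where
  "D p u = multi_power (partial_deriv mv_x) p u"

type_synonym 'n jet = "(real^'n) \<times> ('n multi_index \<Rightarrow> real)"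

fun mv_jet :: "'n::finite + 'n multi_index \<Rightarrow> real \<Rightarrow> 'n jet \<Rightarrow> 'n jet" where
  "mv_jet (Inl i) t (x, \<xi>) = (mv_x i t x, \<xi>)"
| "mv_jet (Inr p) t (x, \<xi>) = (x, \<xi>(p := \<xi> p + t))"

text \<open>
  \<open>F\<close> is a function of \<open>x \<in> X\<close> and of the \<open>\<xi>\<^sub>p\<close> with \<open>|p| \<le> m\<close> only, jointly smooth in these
  variables.  In the presence of the first condition, continuity with respect to the product
  topology is ordinary joint continuity in finitely many real variables.
\<close>

definition smooth_jet_fun :: "(real^'n::finite) set \<Rightarrow> nat \<Rightarrow> ('n jet \<Rightarrow> real) \<Rightarrow> bool" where
  "smooth_jet_fun X m F \<longleftrightarrow>
     (\<forall>x\<in>X. \<forall>\<xi> \<eta>. (\<forall>p. mi_order p \<le> m \<longrightarrow> \<xi> p = \<eta> p) \<longrightarrow> F (x, \<xi>) = F (x, \<eta>)) \<and>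
     C_infinity mv_jet (range Inl \<union> Inr ` {p. mi_order p \<le> m}) (X \<times> UNIV) F"

definition pde_op :: "('n::finite jet \<Rightarrow> real) \<Rightarrow> (real^'n \<Rightarrow> real) \<Rightarrow> real^'n \<Rightarrow> real" where
  "pde_op F u x = F (x, \<lambda>p. D p u x)"

text \<open>
  The chain rule: if \<open>G\<close> involves only \<open>\<xi>\<^sub>p\<close> with \<open>|p| \<le> k\<close>, then
  \<open>\<partial>\<^sub>i (x \<mapsto> G (x, (D\<^sup>p u x)\<^sub>p))\<close> at \<open>x\<close> is \<open>total_deriv k i G\<close> at \<open>(x, (D\<^sup>p u x)\<^sub>p)\<close>.
\<close>

definition total_deriv :: "nat \<Rightarrow> 'n::finite \<Rightarrow> ('n jet \<Rightarrow> real) \<Rightarrow> 'n jet \<Rightarrow> real" where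
  "total_deriv k i G = (\<lambda>(x, \<xi>).
     partial_deriv mv_jet (Inl i) G (x, \<xi>) +
     (\<Sum>p | mi_order p \<le> k. partial_deriv mv_jet (Inr p) G (x, \<xi>) * \<xi> (p + axis i 1)))"

text \<open>
  This is \<open>F\<^sup>l\<close>, that is, \<open>\<Sum>\<^bsub>|p| \<le> l\<^esub> (D\<^sup>p (T(x,D)U(x) - f(x)))\<^sup>2\<close> with the derivatives carried out.
  All intermediate functions involve only \<open>\<xi>\<^sub>p\<close> with \<open>|p| \<le> m + l\<close>, so that the bound \<open>m + l\<close> can be
  used for every total derivative; terms beyond the actual order of a function vanish.
\<close>

definition F_l :: "nat \<Rightarrow> ('n::finite jet \<Rightarrow> real) \<Rightarrow> (real^'n \<Rightarrow> real) \<Rightarrow> nat \<Rightarrow> 'n jet \<Rightarrow> real" where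
  "F_l m F f l z =
     (\<Sum>p | mi_order p \<le> l. (multi_power (total_deriv (m + l)) p (\<lambda>(x, \<xi>). F (x, \<xi>) - f x) z)\<^sup>2)"

definition R_l ::
  "nat \<Rightarrow> ('n::finite jet \<Rightarrow> real) \<Rightarrow> (real^'n \<Rightarrow> real) \<Rightarrow> nat \<Rightarrow> real^'n \<Rightarrow> real set" where
  "R_l m F f l x = {F_l m F f l (x, \<xi>) | \<xi>. True}"

definition smooth_seqs :: "(real^'n::finite) set \<Rightarrow> (nat \<Rightarrow> real^'n \<Rightarrow> real) ring" where
  "smooth_seqs X =
     \<lparr>carrier = {s. \<forall>\<nu>. smooth_on X (s \<nu>)},
      mult = (\<lambda>s t \<nu> x. s \<nu> x * t \<nu> x), one = (\<lambda>\<nu> x. 1),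
      zero = (\<lambda>\<nu> x. 0), add = (\<lambda>s t \<nu> x. s \<nu> x + t \<nu> x)\<rparr>"

definition J_ideal :: "(real^'n::finite) set \<Rightarrow> (real^'n) set \<Rightarrow> (nat \<Rightarrow> real^'n \<Rightarrow> real) set" where
  "J_ideal X \<Sigma> =
     {w \<in> carrier (smooth_seqs X).
        \<forall>x\<in>X - \<Sigma>. \<forall>l. \<exists>\<nu>. \<forall>\<mu>\<ge>\<nu>. \<forall>p. mi_order p \<le> l \<longrightarrow> D p (w \<mu>) x = 0}"

definition B_alg ::
  "(real^'n::finite) set \<Rightarrow> (real^'n) set \<Rightarrow> ((nat \<Rightarrow> real^'n \<Rightarrow> real) set) ring" where
  "B_alg X \<Sigma> = smooth_seqs X Quot J_ideal X \<Sigma>"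

definition gen_class ::
  "(real^'n::finite) set \<Rightarrow> (real^'n) set \<Rightarrow> (nat \<Rightarrow> real^'n \<Rightarrow> real)
    \<Rightarrow> (nat \<Rightarrow> real^'n \<Rightarrow> real) set" where
  "gen_class X \<Sigma> s = J_ideal X \<Sigma> +>\<^bsub>smooth_seqs X\<^esub> s"

definition const_class ::
  "(real^'n::finite) set \<Rightarrow> (real^'n) set \<Rightarrow> (real^'n \<Rightarrow> real) \<Rightarrow> (nat \<Rightarrow> real^'n \<Rightarrow> real) set" where
  "const_class X \<Sigma> \<psi> = gen_class X \<Sigma> (\<lambda>\<nu>. \<psi>)"

text \<open>
  The union of the classes obtained from all representatives; it is a single class because the
  class of \<open>T(x,D) s\<close> does not depend on the representative \<open>s\<close>.
\<close>

definition pde_op_B ::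
  "(real^'n::finite) set \<Rightarrow> (real^'n) set \<Rightarrow> ('n jet \<Rightarrow> real)
    \<Rightarrow> (nat \<Rightarrow> real^'n \<Rightarrow> real) set \<Rightarrow> (nat \<Rightarrow> real^'n \<Rightarrow> real) set" where
  "pde_op_B X \<Sigma> F U = (\<Union>s\<in>U. gen_class X \<Sigma> (\<lambda>\<nu>. pde_op F (s \<nu>)))"

end

theory Submission
  imports Defs
begin

text \<open>
  The elements of the algebra are sequences, and a sequence represents zero if at each point
  outside \<open>\<Sigma>\<close> and for each \<open>l\<close> its terms eventually vanish to order \<open>l\<close> there.  The points outside
  \<open>\<Sigma>\<close> only have to be dense, so they can be taken to be a countable dense subset
  \<open>{x\<^sub>0, x\<^sub>1, \<dots>}\<close> of \<open>X_sol\<close>.  Then it suffices to find, for each \<open>\<nu>\<close>, one smooth function \<open>s\<^sub>\<nu>\<close>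
  that solves the equation to order \<open>\<nu>\<close> at the finitely many points \<open>x\<^sub>0, \<dots>, x\<^sub>\<nu>\<close>: every point and
  every order is covered from some index on.

  Solving to order \<open>\<nu>\<close> at one point is a pointwise condition on the jet of \<open>s\<^sub>\<nu>\<close> of order
  \<open>m + \<nu>\<close> there.  By the chain rule (\<open>D_pde_op\<close>), the derivatives of \<open>T(x,D) s\<^sub>\<nu> - f\<close> are the
  iterated total derivatives of \<open>F - f\<close> evaluated at this jet, and \<open>0 \<in> R\<^sup>l\<^sub>x\<close> for \<open>l = \<nu>\<close> says that
  they have a common zero, since a sum of real squares vanishes only if each square does.  Finally,
  arbitrary jets of finite order at finitely many points are realised by a polynomial
  (\<open>smooth_interpolation\<close>), glued from Taylor polynomials by polynomial cutoffs that are flat to the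
  required order.

  The chain rule has to be derived from smoothness in terms of iterated partial derivatives.
  Continuity of the partial derivatives gives it by the mean value theorem, one jet variable at a
  time (\<open>DERIV_increment\<close>, \<open>DERIV_jet_curve\<close>), together with the symmetry of mixed derivatives
  (\<open>partial_deriv_commute\<close>), which says that \<open>\<partial>\<^sub>i D\<^sup>p u\<close> is again a component of the jet of \<open>u\<close>.
\<close>

section \<open>Smoothness along translations\<close>

text \<open>
  A word-indexed definition of smoothness does not combine well with the product rule, where one
  derivative of a product becomes a sum of two products.  The order-by-order version is closed
  under sums first and then, by induction on the order, under products.
\<close>

fun C_upto ::
  "('d \<Rightarrow> real \<Rightarrow> 'a \<Rightarrow> 'a) \<Rightarrow> 'a::topological_space set \<Rightarrow> nat \<Rightarrow> ('a \<Rightarrow> real) \<Rightarrow> bool" where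
  "C_upto mv S 0 g \<longleftrightarrow> continuous_on S g"
| "C_upto mv S (Suc k) g \<longleftrightarrow> continuous_on S g \<and>
     (\<forall>d. (\<forall>a\<in>S. (\<lambda>t. g (mv d t a)) differentiable (at 0)) \<and> C_upto mv S k (partial_deriv mv d g))"

lemma C_infinity_partial_deriv:
  assumes "C_infinity mv A S g" "d \<in> A"
  shows "C_infinity mv A S (partial_deriv mv d g)"
  unfolding C_infinity_def
proof
  fix ds assume "ds \<in> lists A"
  then have "ds @ [d] \<in> lists A" using assms(2) by simp
  from assms(1)[unfolded C_infinity_def, THEN bspec, OF this]
  show "continuous_on S (foldr (partial_deriv mv) ds (partial_deriv mv d g)) \<and>
    (\<forall>e\<in>A. \<forall>a\<in>S. (\<lambda>t. foldr (partial_deriv mv) ds (partial_deriv mv d g) (mv e t a))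
       differentiable at 0)"
    by simp
qed

lemma C_infinity_continuous: "C_infinity mv A S g \<Longrightarrow> continuous_on S g"
  unfolding C_infinity_def by (drule bspec[where x = "[]"]) auto

lemma C_infinity_differentiable:
  "C_infinity mv A S g \<Longrightarrow> d \<in> A \<Longrightarrow> a \<in> S \<Longrightarrow>
    (\<lambda>t. g (mv d t a)) differentiable (at 0)"
  unfolding C_infinity_def by (drule bspec[where x = "[]"]) auto

lemma C_infinity_imp_C_upto: "C_infinity mv UNIV S g \<Longrightarrow> C_upto mv S k g"
  by (induction k arbitrary: g)
    (auto simp: C_infinity_continuous C_infinity_differentiable C_infinity_partial_deriv)

lemma C_infinity_iff: "C_infinity mv UNIV S g \<longleftrightarrow> (\<forall>k. C_upto mv S k g)"
proof (intro iffI allI C_infinity_imp_C_upto)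
  have *: "C_upto mv S (k + length ds) g \<Longrightarrow> C_upto mv S k (foldr (partial_deriv mv) ds g)"
    for ds :: "'a list" and k g
    by (induction ds arbitrary: g rule: rev_induct) auto
  assume "\<forall>k. C_upto mv S k g"
  then have "C_upto mv S (Suc 0) (foldr (partial_deriv mv) ds g)" for ds
    using * by blast
  then show "C_infinity mv UNIV S g"
    unfolding C_infinity_def by auto
qed

lemma C_infinity_foldr:
  "C_infinity mv UNIV S g \<Longrightarrow> C_infinity mv UNIV S (foldr (partial_deriv mv) ds g)"
  by (induction ds) (auto intro: C_infinity_partial_deriv)

text \<open>
  Functions of \<open>x\<close> and functions of jets share one calculus.  All it needs is that each direction
  acts by a continuous one-parameter group: the group law moves a derivative at time \<open>0\<close> to any
  time, and continuity keeps points of the open set \<open>S\<close> inside \<open>S\<close> for small times, so that partial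
  derivatives on \<open>S\<close> depend on the values on \<open>S\<close> only.
\<close>

locale partial_flow =
  fixes mv :: "'d \<Rightarrow> real \<Rightarrow> 'a::topological_space \<Rightarrow> 'a" and S :: "'a set"
  assumes open_domain: "open S"
    and mv_zero [simp]: "mv d 0 a = a"
    and mv_mv: "mv d s (mv d t a) = mv d (s + t) a"
    and continuous_mv: "continuous_on UNIV (\<lambda>(t, a). mv d t a)"
begin

lemma tendsto_mv:
  assumes "(b \<longlongrightarrow> t) Fl" "(z \<longlongrightarrow> a) Fl"
  shows "((\<lambda>x. mv d (b x) (z x)) \<longlongrightarrow> mv d t a) Fl"
  using continuous_on_tendsto_compose[OF continuous_mv tendsto_Pair[OF assms]] by simp

lemma eventually_mv_in_domain:
  assumes "a \<in> S"
  shows "eventually (\<lambda>t. mv d t a \<in> S) (nhds 0)"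
proof -
  have "((\<lambda>t. mv d t a) \<longlongrightarrow> mv d 0 a) (nhds 0)"
    by (intro tendsto_mv tendsto_const filterlim_ident)
  from topological_tendstoD[OF this open_domain] assms show ?thesis by simp
qed

lemma DERIV_cong_on_domain:
  assumes "\<And>x. x \<in> S \<Longrightarrow> g x = h x" "a \<in> S"
  shows "((\<lambda>t. g (mv d t a)) has_real_derivative c) (at 0) \<longleftrightarrow>
    ((\<lambda>t. h (mv d t a)) has_real_derivative c) (at 0)"
proof (rule DERIV_cong_ev)
  show "eventually (\<lambda>t. g (mv d t a) = h (mv d t a)) (nhds 0)"
    using eventually_mv_in_domain[OF assms(2)] by (rule eventually_mono) (rule assms(1))
qed simp_all

lemma partial_deriv_cong:
  assumes "\<And>x. x \<in> S \<Longrightarrow> g x = h x" "a \<in> S"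
  shows "partial_deriv mv d g a = partial_deriv mv d h a"
  unfolding partial_deriv_def deriv_def using DERIV_cong_on_domain[of g h a d, OF assms] by simp

lemma C_upto_cong:
  assumes "C_upto mv S k g" "\<And>x. x \<in> S \<Longrightarrow> g x = h x"
  shows "C_upto mv S k h"
  using assms
proof (induction k arbitrary: g h)
  case 0
  then show ?case by (auto cong: continuous_on_cong)
next
  case (Suc k)
  have "(\<lambda>t. h (mv d t a)) differentiable (at 0)" if "a \<in> S" for d a
    using Suc.prems(1) that DERIV_cong_on_domain[of g h, OF Suc.prems(2)]
    by (auto simp: real_differentiable_def)
  moreover have "C_upto mv S k (partial_deriv mv d h)" for d
    by (rule Suc.IH[of "partial_deriv mv d g"])
      (use Suc.prems in \<open>auto intro: partial_deriv_cong\<close>)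
  moreover have "continuous_on S h"
    using Suc.prems by (auto cong: continuous_on_cong)
  ultimately show ?case by simp
qed

lemma partial_deriv_unique:
  "((\<lambda>t. g (mv d t a)) has_real_derivative c) (at 0) \<Longrightarrow> partial_deriv mv d g a = c"
  unfolding partial_deriv_def by (rule DERIV_imp_deriv)

lemma C_upto_SucI:
  assumes "continuous_on S g"
    and "\<And>d a. a \<in> S \<Longrightarrow> ((\<lambda>t. g (mv d t a)) has_real_derivative g' d a) (at 0)"
    and "\<And>d. C_upto mv S k (g' d)"
  shows "C_upto mv S (Suc k) g"
proof -
  have "C_upto mv S k (partial_deriv mv d g)" for d
    by (rule C_upto_cong[OF assms(3)[of d]])
      (simp add: partial_deriv_unique[OF assms(2)])
  then show ?thesis
    using assms(1,2) by (auto simp: real_differentiable_def)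
qed

lemma DERIV_partial:
  assumes "C_upto mv S (Suc k) g" "a \<in> S"
  shows "((\<lambda>t. g (mv d t a)) has_real_derivative partial_deriv mv d g a) (at 0)"
  using assms by (simp add: partial_deriv_def DERIV_deriv_iff_real_differentiable)

lemma DERIV_partial_at:
  assumes "C_upto mv S (Suc k) g" "mv d t a \<in> S"
  shows "((\<lambda>t. g (mv d t a)) has_real_derivative partial_deriv mv d g (mv d t a)) (at t)"
proof -
  have "((\<lambda>s. g (mv d (s + t) a)) has_real_derivative partial_deriv mv d g (mv d t a)) (at 0)"
    using DERIV_partial[OF assms, of d] by (simp add: mv_mv)
  then show ?thesis
    using DERIV_shift[of "\<lambda>t. g (mv d t a)" "partial_deriv mv d g (mv d t a)" 0 t] by simp
qed

lemma C_upto_Suc_imp: "C_upto mv S (Suc k) g \<Longrightarrow> C_upto mv S k g"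
  by (induction k arbitrary: g) auto

lemma C_upto_zero: "C_upto mv S k (\<lambda>_. 0)"
proof (induction k)
  case (Suc k)
  then show ?case by (intro C_upto_SucI[where g' = "\<lambda>_ _. 0"]) (auto intro!: derivative_eq_intros)
qed simp

lemma C_upto_const: "C_upto mv S k (\<lambda>_. c)"
proof (cases k)
  case (Suc l)
  show ?thesis unfolding Suc
    by (intro C_upto_SucI[where g' = "\<lambda>_ _. 0"] C_upto_zero) (auto intro!: derivative_eq_intros)
qed simp

lemma C_upto_add:
  "C_upto mv S k g \<Longrightarrow> C_upto mv S k h \<Longrightarrow> C_upto mv S k (\<lambda>x. g x + h x)"
proof (induction k arbitrary: g h)
  case 0
  then show ?case by (auto intro: continuous_intros)
next
  case (Suc k)
  show ?case
  proof (rule C_upto_SucI)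
    show "C_upto mv S k (\<lambda>a. partial_deriv mv d g a + partial_deriv mv d h a)" for d
      using Suc by simp
    show "((\<lambda>t. g (mv d t a) + h (mv d t a)) has_real_derivative
        partial_deriv mv d g a + partial_deriv mv d h a) (at 0)" if "a \<in> S" for d a
      by (intro DERIV_add DERIV_partial[OF Suc.prems(1) that] DERIV_partial[OF Suc.prems(2) that])
  qed (use Suc.prems in \<open>auto intro: continuous_intros\<close>)
qed

lemma C_upto_mult:
  "C_upto mv S k g \<Longrightarrow> C_upto mv S k h \<Longrightarrow> C_upto mv S k (\<lambda>x. g x * h x)"
proof (induction k arbitrary: g h)
  case 0
  then show ?case by (auto intro: continuous_intros)
next
  case (Suc k)
  show ?case
  proof (rule C_upto_SucI)
    show "C_upto mv S k (\<lambda>a. partial_deriv mv d g a * h a + g a * partial_deriv mv d h a)" for d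
      by (intro C_upto_add Suc.IH C_upto_Suc_imp[OF Suc.prems(1)] C_upto_Suc_imp[OF Suc.prems(2)])
        (use Suc.prems in simp_all)
    show "((\<lambda>t. g (mv d t a) * h (mv d t a)) has_real_derivative
        partial_deriv mv d g a * h a + g a * partial_deriv mv d h a) (at 0)" if "a \<in> S" for d a
      using DERIV_mult[OF DERIV_partial[OF Suc.prems(1) that] DERIV_partial[OF Suc.prems(2) that]]
      by (simp add: mult.commute)
  qed (use Suc.prems in \<open>auto intro: continuous_intros\<close>)
qed

lemma C_infinity_const: "C_infinity mv UNIV S (\<lambda>_. c)"
  by (simp add: C_infinity_iff C_upto_const)

lemma C_infinity_add:
  "C_infinity mv UNIV S g \<Longrightarrow> C_infinity mv UNIV S h \<Longrightarrow> C_infinity mv UNIV S (\<lambda>x. g x + h x)"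
  by (simp add: C_infinity_iff C_upto_add)

lemma C_infinity_mult:
  "C_infinity mv UNIV S g \<Longrightarrow> C_infinity mv UNIV S h \<Longrightarrow> C_infinity mv UNIV S (\<lambda>x. g x * h x)"
  by (simp add: C_infinity_iff C_upto_mult)

lemma C_infinity_minus:
  "C_infinity mv UNIV S g \<Longrightarrow> C_infinity mv UNIV S (\<lambda>x. - g x)"
  using C_infinity_mult[OF C_infinity_const[of "-1"]] by simp

lemma C_infinity_diff:
  "C_infinity mv UNIV S g \<Longrightarrow> C_infinity mv UNIV S h \<Longrightarrow> C_infinity mv UNIV S (\<lambda>x. g x - h x)"
  using C_infinity_add[OF _ C_infinity_minus] by simp

lemma C_infinity_sum:
  "(\<And>i. i \<in> I \<Longrightarrow> C_infinity mv UNIV S (g i)) \<Longrightarrow> C_infinity mv UNIV S (\<lambda>x. \<Sum>i\<in>I. g i x)"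
  by (induction I rule: infinite_finite_induct) (auto intro: C_infinity_add C_infinity_const)

lemma C_infinity_prod:
  "(\<And>i. i \<in> I \<Longrightarrow> C_infinity mv UNIV S (g i)) \<Longrightarrow> C_infinity mv UNIV S (\<lambda>x. \<Prod>i\<in>I. g i x)"
  by (induction I rule: infinite_finite_induct) (auto intro: C_infinity_mult C_infinity_const)

lemma C_infinity_power:
  "C_infinity mv UNIV S g \<Longrightarrow> C_infinity mv UNIV S (\<lambda>x. g x ^ j)"
  by (induction j) (auto intro: C_infinity_mult C_infinity_const)

lemma C_infinity_DERIV:
  "C_infinity mv UNIV S g \<Longrightarrow> a \<in> S \<Longrightarrow>
    ((\<lambda>t. g (mv d t a)) has_real_derivative partial_deriv mv d g a) (at 0)"
  using DERIV_partial[of 0] by (metis C_infinity_iff)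

lemma partial_deriv_add:
  assumes "C_infinity mv UNIV S g" "C_infinity mv UNIV S h" "a \<in> S"
  shows "partial_deriv mv d (\<lambda>x. g x + h x) a = partial_deriv mv d g a + partial_deriv mv d h a"
  by (intro partial_deriv_unique DERIV_add C_infinity_DERIV assms)

lemma partial_deriv_mult:
  assumes "C_infinity mv UNIV S g" "C_infinity mv UNIV S h" "a \<in> S"
  shows "partial_deriv mv d (\<lambda>x. g x * h x) a =
    partial_deriv mv d g a * h a + g a * partial_deriv mv d h a"
  using DERIV_mult[OF C_infinity_DERIV[OF assms(1,3)] C_infinity_DERIV[OF assms(2,3)], of d d]
  by (intro partial_deriv_unique) (simp add: mult.commute)

lemma foldr_partial_deriv_add:
  assumes "C_infinity mv UNIV S g" "C_infinity mv UNIV S h" "a \<in> S"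
  shows "foldr (partial_deriv mv) ds (\<lambda>x. g x + h x) a =
    foldr (partial_deriv mv) ds g a + foldr (partial_deriv mv) ds h a"
  using assms(3)
proof (induction ds arbitrary: a)
  case (Cons d ds)
  have "foldr (partial_deriv mv) (d # ds) (\<lambda>x. g x + h x) a =
      partial_deriv mv d (\<lambda>x. foldr (partial_deriv mv) ds g x + foldr (partial_deriv mv) ds h x) a"
    using Cons by (auto intro: partial_deriv_cong)
  then show ?case
    using Cons.prems by (simp add: partial_deriv_add C_infinity_foldr assms)
qed simp

lemma foldr_partial_deriv_zero:
  "a \<in> S \<Longrightarrow> foldr (partial_deriv mv) ds (\<lambda>_. 0) a = 0"
proof (induction ds arbitrary: a)
  case (Cons d ds)
  have "partial_deriv mv d (foldr (partial_deriv mv) ds (\<lambda>_. 0)) a = partial_deriv mv d (\<lambda>_. 0) a"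
    using Cons by (intro partial_deriv_cong) auto
  then show ?case
    using partial_deriv_unique[of "\<lambda>_. 0" d a 0] by simp
qed simp

lemma foldr_partial_deriv_minus:
  assumes "C_infinity mv UNIV S g" "a \<in> S"
  shows "foldr (partial_deriv mv) ds (\<lambda>x. - g x) a = - foldr (partial_deriv mv) ds g a"
  using foldr_partial_deriv_add[OF assms(1) C_infinity_minus[OF assms(1)] assms(2), of ds]
    foldr_partial_deriv_zero[OF assms(2), of ds] by simp

section \<open>Increments and the symmetry of mixed derivatives\<close>

text \<open>
  This is the only place where continuity of a partial derivative enters the chain rule: while the
  base point \<open>z t\<close> moves, the increment in the direction \<open>d\<close> equals \<open>b t\<close> times the partial
  derivative at an intermediate point, by the mean value theorem, and that point tends to \<open>z 0\<close>.
\<close>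

lemma DERIV_increment:
  assumes g: "C_infinity mv UNIV S g"
    and b: "(b has_real_derivative \<beta>) (at 0)" "b 0 = 0"
    and z: "isCont z 0" "z 0 \<in> S"
  shows "((\<lambda>t. g (mv d (b t) (z t)) - g (z t)) has_real_derivative partial_deriv mv d g (z 0) * \<beta>)
    (at 0)"
proof -
  let ?G = "partial_deriv mv d g"
  have g1: "C_upto mv S (Suc 0) g"
    using g C_infinity_iff by blast
  have "((\<lambda>(s, x). mv d s x) \<longlongrightarrow> mv d 0 (z 0)) (nhds (0, z 0))"
    using tendsto_mv[of fst 0 "nhds (0, z 0)" snd "z 0" d]
      tendsto_fst[OF filterlim_ident[of "nhds (0, z 0)"]]
      tendsto_snd[OF filterlim_ident[of "nhds (0, z 0)"]]
    by (simp add: split_def)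
  from topological_tendstoD[OF this open_domain] z(2)
  have "eventually (\<lambda>(s, x). mv d s x \<in> S) (nhds 0 \<times>\<^sub>F nhds (z 0))"
    by (simp add: nhds_prod split_def)
  then obtain P Q where PQ: "eventually P (nhds (0::real))" "eventually Q (nhds (z 0))"
    "\<And>s x. P s \<Longrightarrow> Q x \<Longrightarrow> mv d s x \<in> S"
    by (auto simp: eventually_prod_filter)
  obtain \<epsilon> where \<epsilon>: "\<epsilon> > 0" "\<And>s. \<bar>s\<bar> < \<epsilon> \<Longrightarrow> P s"
    using PQ(1) by (auto simp: eventually_nhds_metric)
  have b_lim: "(b \<longlongrightarrow> 0) (at 0)"
    using DERIV_isCont[OF b(1)] b(2) by (simp add: isCont_def)
  have z_lim: "(z \<longlongrightarrow> z 0) (at 0)"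
    using z(1) by (simp add: isCont_def)
  let ?ok = "\<lambda>t. \<bar>b t\<bar> < \<epsilon> \<and> Q (z t)"
  have ok: "eventually ?ok (at 0)"
    using \<epsilon>(1) b_lim filterlim_iff[THEN iffD1, OF z_lim] PQ(2)
    by (intro eventually_conj) (auto simp: tendsto_iff dist_real_def)
  \<comment> \<open>The intermediate point of the mean value theorem; the sign of \<open>b t\<close> decides the interval.\<close>
  have "\<exists>\<theta>. \<bar>\<theta>\<bar> \<le> \<bar>b t\<bar> \<and> (?ok t \<longrightarrow> mv d \<theta> (z t) \<in> S \<and>
      g (mv d (b t) (z t)) - g (z t) = b t * ?G (mv d \<theta> (z t)))" for t
  proof (cases "?ok t")
    case True
    then have in_S: "mv d s (z t) \<in> S" if "\<bar>s\<bar> \<le> \<bar>b t\<bar>" for s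
      using that \<epsilon>(2) PQ(3) by force
    then have der: "((\<lambda>s. g (mv d s (z t))) has_real_derivative ?G (mv d s (z t))) (at s)"
      if "\<bar>s\<bar> \<le> \<bar>b t\<bar>" for s
      using that by (intro DERIV_partial_at[OF g1]) auto
    consider "b t = 0" | "b t > 0" | "b t < 0" by linarith
    then show ?thesis
    proof cases
      case 1
      then show ?thesis using in_S[of 0] by (intro exI[of _ 0]) auto
    next
      case 2
      obtain \<theta> where "0 < \<theta>" "\<theta> < b t" "g (mv d (b t) (z t)) - g (mv d 0 (z t)) =
          (b t - 0) * ?G (mv d \<theta> (z t))"
        using MVT2[of 0 "b t" "\<lambda>s. g (mv d s (z t))", OF 2 der] by auto
      then show ?thesis using in_S by (intro exI[of _ \<theta>]) auto
    next
      case 3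
      obtain \<theta> where "b t < \<theta>" "\<theta> < 0" "g (mv d 0 (z t)) - g (mv d (b t) (z t)) =
          (0 - b t) * ?G (mv d \<theta> (z t))"
        using MVT2[of "b t" 0 "\<lambda>s. g (mv d s (z t))", OF 3 der] by auto
      then show ?thesis using in_S by (intro exI[of _ \<theta>]) auto
    qed
  qed (auto intro: exI[of _ 0])
  then obtain \<theta> where \<theta>: "\<And>t. \<bar>\<theta> t\<bar> \<le> \<bar>b t\<bar>"
    "\<And>t. ?ok t \<Longrightarrow> mv d (\<theta> t) (z t) \<in> S \<and>
      g (mv d (b t) (z t)) - g (z t) = b t * ?G (mv d (\<theta> t) (z t))"
    by metis
  have "(\<theta> \<longlongrightarrow> 0) (at 0)"
    by (rule Lim_null_comparison[where g = "\<lambda>t. \<bar>b t\<bar>"])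
      (use \<theta>(1) tendsto_rabs[OF b_lim] in auto)
  from tendsto_mv[OF this z_lim, of d]
  have "((\<lambda>t. mv d (\<theta> t) (z t)) \<longlongrightarrow> z 0) (at 0)" by simp
  then have G_lim: "((\<lambda>t. ?G (mv d (\<theta> t) (z t))) \<longlongrightarrow> ?G (z 0)) (at 0)"
    by (rule continuous_on_tendsto_compose[OF C_infinity_continuous[OF C_infinity_partial_deriv[OF g UNIV_I]]
          _ z(2)]) (use ok \<theta>(2) in \<open>auto elim!: eventually_mono\<close>)
  have "((\<lambda>t. b t / t) \<longlongrightarrow> \<beta>) (at 0)"
    using b by (simp add: DERIV_def)
  from tendsto_mult[OF G_lim this]
  have "((\<lambda>t. ?G (mv d (\<theta> t) (z t)) * (b t / t)) \<longlongrightarrow> ?G (z 0) * \<beta>) (at 0)" .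
  then have "((\<lambda>t. (g (mv d (b t) (z t)) - g (z t)) / t) \<longlongrightarrow> ?G (z 0) * \<beta>) (at 0)"
    by (rule Lim_transform_eventually) (use ok \<theta>(2) in \<open>auto elim!: eventually_mono\<close>)
  then show ?thesis
    using b(2) by (simp add: DERIV_def)
qed

text \<open>
  Two applications of the mean value theorem turn the second difference into \<open>h\<^sup>2\<close> times the mixed
  derivative at an intermediate point.  The second difference is symmetric in the two directions,
  whereas the limit found here takes the derivatives in a definite order; Schwarz's theorem follows.
\<close>

lemma second_difference_quotient_tendsto:
  assumes g: "C_infinity mv UNIV S g" and a: "a \<in> S"
    and comm: "\<And>s t x. mv i s (mv j t x) = mv j t (mv i s x)"
  shows "((\<lambda>h. (g (mv i h (mv j h a)) - g (mv i h a) - g (mv j h a) + g a) / h\<^sup>2)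
    \<longlongrightarrow> partial_deriv mv j (partial_deriv mv i g) a) (at_right 0)"
proof -
  let ?gi = "partial_deriv mv i g" and ?gji = "partial_deriv mv j (partial_deriv mv i g)"
  let ?\<Delta> = "\<lambda>h. g (mv i h (mv j h a)) - g (mv i h a) - g (mv j h a) + g a"
  have gi: "C_infinity mv UNIV S ?gi"
    using g by (rule C_infinity_partial_deriv) simp
  then have gji: "C_infinity mv UNIV S ?gji"
    by (rule C_infinity_partial_deriv) simp
  have upto: "C_upto mv S (Suc 0) g" "C_upto mv S (Suc 0) ?gi"
    using g gi C_infinity_iff by blast+
  have "((\<lambda>z. mv i (fst z) (mv j (snd z) a)) \<longlongrightarrow> mv i 0 (mv j 0 a)) (nhds (0, 0))"
    using tendsto_fst[OF filterlim_ident[of "nhds (0, 0)"]]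
      tendsto_snd[OF filterlim_ident[of "nhds (0, 0)"]]
    by (intro tendsto_mv) auto
  from topological_tendstoD[OF this open_domain] a
  have "eventually (\<lambda>(s, t). mv i s (mv j t a) \<in> S) (nhds 0 \<times>\<^sub>F nhds 0)"
    by (simp add: nhds_prod split_def)
  then obtain P Q where PQ: "eventually P (nhds (0::real))" "eventually Q (nhds (0::real))"
    "\<And>s t. P s \<Longrightarrow> Q t \<Longrightarrow> mv i s (mv j t a) \<in> S"
    by (auto simp: eventually_prod_filter)
  obtain \<epsilon> where \<epsilon>: "\<epsilon> > 0" "\<And>s. \<bar>s\<bar> < \<epsilon> \<Longrightarrow> P s \<and> Q s"
    using eventually_conj[OF PQ(1,2)] by (auto simp: eventually_nhds_metric)
  have in_S: "mv i s (mv j t a) \<in> S" if "\<bar>s\<bar> < \<epsilon>" "\<bar>t\<bar> < \<epsilon>" for s t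
    using \<epsilon>(2) PQ(3) that by blast
  have in_S_i: "mv i s a \<in> S" if "\<bar>s\<bar> < \<epsilon>" for s
    using in_S[of s 0] that \<epsilon>(1) by simp
  have "\<exists>\<sigma> \<tau>. 0 < \<sigma> \<and> \<sigma> < h \<and> 0 < \<tau> \<and> \<tau> < h \<and> mv i \<sigma> (mv j \<tau> a) \<in> S \<and>
      ?\<Delta> h = h\<^sup>2 * ?gji (mv i \<sigma> (mv j \<tau> a))" if h: "0 < h" "h < \<epsilon>" for h
  proof -
    have "((\<lambda>s. g (mv i s (mv j h a)) - g (mv i s a)) has_real_derivative
        ?gi (mv i s (mv j h a)) - ?gi (mv i s a)) (at s)" if "0 \<le> s" "s \<le> h" for s
      using that h by (intro DERIV_diff DERIV_partial_at[OF upto(1)] in_S in_S_i) auto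
    from MVT2[OF h(1) this] obtain \<sigma> where \<sigma>: "0 < \<sigma>" "\<sigma> < h"
      "?\<Delta> h = h * (?gi (mv i \<sigma> (mv j h a)) - ?gi (mv i \<sigma> a))"
      by auto
    have "((\<lambda>t. ?gi (mv j t (mv i \<sigma> a))) has_real_derivative ?gji (mv j t (mv i \<sigma> a))) (at t)"
      if "0 \<le> t" "t \<le> h" for t
      using that h \<sigma> comm[symmetric] by (intro DERIV_partial_at[OF upto(2)]) (simp add: in_S)
    from MVT2[OF h(1) this] obtain \<tau> where "0 < \<tau>" "\<tau> < h"
      "?gi (mv j h (mv i \<sigma> a)) - ?gi (mv i \<sigma> a) = h * ?gji (mv j \<tau> (mv i \<sigma> a))"
      by auto
    then show ?thesis
      using \<sigma> h comm[symmetric] in_S[of \<sigma> \<tau>] by (auto simp: power2_eq_square)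
  qed
  then obtain \<sigma> \<tau> where st: "\<And>h. 0 < h \<Longrightarrow> h < \<epsilon> \<Longrightarrow> 0 < \<sigma> h \<and> \<sigma> h < h \<and> 0 < \<tau> h \<and> \<tau> h < h \<and>
      mv i (\<sigma> h) (mv j (\<tau> h) a) \<in> S \<and> ?\<Delta> h = h\<^sup>2 * ?gji (mv i (\<sigma> h) (mv j (\<tau> h) a))"
    by metis
  have ev: "eventually (\<lambda>h. 0 < h \<and> h < \<epsilon>) (at_right 0)"
    using eventually_at_right_real[OF \<epsilon>(1)] by (auto elim: eventually_mono)
  have id_lim: "((\<lambda>h. h) \<longlongrightarrow> (0::real)) (at_right 0)"
    by (rule tendsto_ident_at)
  have "(\<sigma> \<longlongrightarrow> 0) (at_right 0)"
  proof (rule tendsto_sandwich[OF _ _ tendsto_const id_lim])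
    show "eventually (\<lambda>h. 0 \<le> \<sigma> h) (at_right 0)" "eventually (\<lambda>h. \<sigma> h \<le> h) (at_right 0)"
      using ev by (rule eventually_mono, use st less_imp_le in blast)+
  qed
  moreover have "(\<tau> \<longlongrightarrow> 0) (at_right 0)"
  proof (rule tendsto_sandwich[OF _ _ tendsto_const id_lim])
    show "eventually (\<lambda>h. 0 \<le> \<tau> h) (at_right 0)" "eventually (\<lambda>h. \<tau> h \<le> h) (at_right 0)"
      using ev by (rule eventually_mono, use st less_imp_le in blast)+
  qed
  ultimately have "((\<lambda>h. mv i (\<sigma> h) (mv j (\<tau> h) a)) \<longlongrightarrow> mv i 0 (mv j 0 a)) (at_right 0)"
    by (intro tendsto_mv tendsto_const)
  then have lim: "((\<lambda>h. mv i (\<sigma> h) (mv j (\<tau> h) a)) \<longlongrightarrow> a) (at_right 0)"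
    by simp
  have "eventually (\<lambda>h. mv i (\<sigma> h) (mv j (\<tau> h) a) \<in> S) (at_right 0)"
    using ev by (rule eventually_mono) (use st in blast)
  from continuous_on_tendsto_compose[OF C_infinity_continuous[OF gji] lim a this]
  have "((\<lambda>h. ?gji (mv i (\<sigma> h) (mv j (\<tau> h) a))) \<longlongrightarrow> ?gji a) (at_right 0)" .
  moreover have "eventually (\<lambda>h. ?gji (mv i (\<sigma> h) (mv j (\<tau> h) a)) = ?\<Delta> h / h\<^sup>2) (at_right 0)"
    using ev
  proof (rule eventually_mono)
    fix h :: real assume h: "0 < h \<and> h < \<epsilon>"
    then have "?\<Delta> h = h\<^sup>2 * ?gji (mv i (\<sigma> h) (mv j (\<tau> h) a))"
      using st by blast
    then show "?gji (mv i (\<sigma> h) (mv j (\<tau> h) a)) = ?\<Delta> h / h\<^sup>2"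
      unfolding \<open>?\<Delta> h = _\<close> using h by simp
  qed
  ultimately show ?thesis
    by (rule Lim_transform_eventually)
qed

lemma partial_deriv_commute:
  assumes g: "C_infinity mv UNIV S g" and a: "a \<in> S"
    and comm: "\<And>i j s t x. mv i s (mv j t x) = mv j t (mv i s x)"
  shows "partial_deriv mv i (partial_deriv mv j g) a = partial_deriv mv j (partial_deriv mv i g) a"
proof -
  have ji: "((\<lambda>h. (g (mv j h (mv i h a)) - g (mv j h a) - g (mv i h a) + g a) / h\<^sup>2)
      \<longlongrightarrow> partial_deriv mv i (partial_deriv mv j g) a) (at_right 0)"
    using comm by (rule second_difference_quotient_tendsto[OF g a])
  have ij: "((\<lambda>h. (g (mv i h (mv j h a)) - g (mv i h a) - g (mv j h a) + g a) / h\<^sup>2)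
      \<longlongrightarrow> partial_deriv mv j (partial_deriv mv i g) a) (at_right 0)"
    using comm by (rule second_difference_quotient_tendsto[OF g a])
  have "(\<lambda>h. (g (mv j h (mv i h a)) - g (mv j h a) - g (mv i h a) + g a) / h\<^sup>2) =
      (\<lambda>h. (g (mv i h (mv j h a)) - g (mv i h a) - g (mv j h a) + g a) / h\<^sup>2)"
    by (simp add: comm[of j _ i] algebra_simps)
  from tendsto_unique[OF trivial_limit_at_right_real ji[unfolded this] ij] show ?thesis .
qed

text \<open>
  An additional derivative may be taken first or last.  Hence iterated derivatives depend only on
  the multiset of directions, which makes \<open>D\<close> independent of the enumeration of
  the coordinates on smooth functions.
\<close>

lemma foldr_partial_deriv_snoc:
  assumes g: "C_infinity mv UNIV S g" and a: "a \<in> S"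
    and comm: "\<And>i j s t x. mv i s (mv j t x) = mv j t (mv i s x)"
  shows "foldr (partial_deriv mv) ds (partial_deriv mv d g) a =
    partial_deriv mv d (foldr (partial_deriv mv) ds g) a"
  using a
proof (induction ds arbitrary: a)
  case (Cons e ds)
  have "partial_deriv mv e (foldr (partial_deriv mv) ds (partial_deriv mv d g)) a =
      partial_deriv mv e (partial_deriv mv d (foldr (partial_deriv mv) ds g)) a"
    using Cons.IH Cons.prems by (rule partial_deriv_cong)
  also have "\<dots> = partial_deriv mv d (partial_deriv mv e (foldr (partial_deriv mv) ds g)) a"
    by (rule partial_deriv_commute[OF C_infinity_foldr[OF g] Cons.prems comm])
  finally show ?case by simp
qed simp

lemma foldr_partial_deriv_mset_cong:
  assumes g: "C_infinity mv UNIV S g"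
    and comm: "\<And>i j s t x. mv i s (mv j t x) = mv j t (mv i s x)"
    and "mset ds = mset es" "a \<in> S"
  shows "foldr (partial_deriv mv) ds g a = foldr (partial_deriv mv) es g a"
  using assms(3,4)
proof (induction ds arbitrary: es a)
  case (Cons d ds)
  from Cons.prems(1) have "d \<in> set es"
    by (metis list.set_intros(1) mset_eq_setD)
  then obtain bs cs where es: "es = bs @ d # cs"
    by (auto dest: split_list)
  with Cons.prems(1) have "mset ds = mset (bs @ cs)" by simp
  then have "foldr (partial_deriv mv) ds g x = foldr (partial_deriv mv) (bs @ cs) g x"
    if "x \<in> S" for x
    using Cons.IH that by blast
  then have "partial_deriv mv d (foldr (partial_deriv mv) ds g) a =
      partial_deriv mv d (foldr (partial_deriv mv) (bs @ cs) g) a"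
    using Cons.prems(2) by (rule partial_deriv_cong)
  then show ?case
    using foldr_partial_deriv_snoc[OF C_infinity_foldr[OF g, of cs] Cons.prems(2) comm, of bs d]
    by (simp add: es)
qed simp

end

section \<open>Multi-indices and the derivatives of smooth functions\<close>

lemma partial_flow_mv_x:
  assumes "open X"
  shows "partial_flow mv_x X"
proof
  show "continuous_on UNIV (\<lambda>(t, a). mv_x d t a)" for d :: 'a
    unfolding mv_x_def split_def by (intro continuous_intros)
qed (auto simp: mv_x_def assms scaleR_add_left)

lemma mv_x_commute: "mv_x i s (mv_x j t x) = mv_x j t (mv_x i s x)"
  by (simp add: mv_x_def)

lemma partial_flow_mv_jet:
  assumes "open X"
  shows "partial_flow mv_jet (X \<times> UNIV)"
proof
  show "open (X \<times> (UNIV :: ('a multi_index \<Rightarrow> real) set))"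
    using assms by (intro open_Times) auto
  show "mv_jet d 0 a = a" for d :: "'a + 'a multi_index" and a
    by (cases d; cases a) (auto simp: mv_x_def)
  show "mv_jet d s (mv_jet d t a) = mv_jet d (s + t) a" for d :: "'a + 'a multi_index" and s t a
    by (cases d; cases a) (auto simp: mv_x_def scaleR_add_left)
  show "continuous_on UNIV (\<lambda>(t, a). mv_jet d t a)" for d :: "'a + 'a multi_index"
  proof (cases d)
    case (Inl i)
    have "(\<lambda>(t, a). mv_jet d t a) = (\<lambda>z. (fst (snd z) + fst z *\<^sub>R axis i 1, snd (snd z)))"
      by (auto simp: Inl mv_x_def)
    then show ?thesis
      by (simp only:) (intro continuous_on_Pair continuous_on_add continuous_on_scaleR
        continuous_on_fst continuous_on_snd continuous_on_const continuous_on_id)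
  next
    case (Inr p)
    have *: "(\<lambda>(t, a). mv_jet d t a) =
        (\<lambda>z. (fst (snd z), \<lambda>q. snd (snd z) q + (if q = p then fst z else 0)))"
      by (auto simp: Inr fun_eq_iff)
    have "continuous_on UNIV (\<lambda>z :: real \<times> 'a jet. snd (snd z))"
      by (intro continuous_on_snd continuous_on_id)
    from continuous_on_product_then_coordinatewise[OF this]
    have "continuous_on UNIV (\<lambda>z :: real \<times> 'a jet. snd (snd z) q + (if q = p then fst z else 0))" for q
      by (cases "q = p") (simp_all add: continuous_on_add continuous_on_fst)
    then show ?thesis
      unfolding * by (intro continuous_on_Pair continuous_on_coordinatewise_then_product
        continuous_on_fst continuous_on_snd continuous_on_id)
  qed
qed

text \<open>
  The order in which \<open>multi_power\<close> applies its operators, as a list of coordinates: statements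
  about \<open>D\<close> and about iterated total derivatives become inductions on lists.
\<close>

definition mi_word :: "'n::finite multi_index \<Rightarrow> 'n list" where
  "mi_word p = concat (map (\<lambda>i. replicate (p $ i) i) coords)"

lemma multi_power_eq_foldr: "multi_power \<delta> p g = foldr \<delta> (mi_word p) g"
proof -
  have "foldr (\<lambda>i. \<delta> i ^^ (p $ i)) js g = foldr \<delta> (concat (map (\<lambda>i. replicate (p $ i) i) js)) g" for js
    by (induction js) (auto simp: foldr_replicate)
  then show ?thesis by (simp add: multi_power_def mi_word_def)
qed

lemma count_mi_word: "count (mset (mi_word p)) i = p $ i"
proof -
  have "count (mset (concat (map (\<lambda>i. replicate (p $ i) i) js))) i = (if i \<in> set js then p $ i else 0)"
    if "distinct js" for js
    using that by (induction js) auto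
  from this[OF coords(2)] show ?thesis by (simp add: mi_word_def coords(1))
qed

lemma length_mi_word: "length (mi_word p) = mi_order p"
  by (simp add: mi_word_def mi_order_def length_concat o_def sum_list_distinct_conv_sum_set coords)

lemma mset_mi_word_add_axis: "mset (mi_word (p + axis i 1)) = mset (i # mi_word p)"
  by (rule multiset_eqI) (simp add: count_mi_word axis_def)

lemma mi_order_add_axis: "mi_order (p + axis i 1) = Suc (mi_order p)"
  using mset_mi_word_add_axis[of p i] by (metis length_mi_word size_mset length_Cons)

lemma D_eq_foldr: "D p u = foldr (partial_deriv mv_x) (mi_word p) u"
  by (simp add: D_def multi_power_eq_foldr)

lemma smooth_on_D: "smooth_on X u \<Longrightarrow> smooth_on X (D p u)"
  by (simp add: smooth_on_def D_eq_foldr C_infinity_foldr)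

text \<open>
  The jet \<open>(D\<^sup>p u x)\<^sub>p\<close> moves by an index shift.  The new derivative has to be sorted into its
  place in the list of coordinates, and this is where the symmetry of mixed derivatives is used.
\<close>

lemma DERIV_D:
  assumes "open X" "smooth_on X u" "x \<in> X"
  shows "((\<lambda>t. D p u (mv_x i t x)) has_real_derivative D (p + axis i 1) u x) (at 0)"
proof -
  interpret partial_flow mv_x X using assms(1) by (rule partial_flow_mv_x)
  have "D (p + axis i 1) u x = foldr (partial_deriv mv_x) (i # mi_word p) u x"
    unfolding D_eq_foldr using assms(2,3)
    by (intro foldr_partial_deriv_mset_cong mset_mi_word_add_axis mv_x_commute)
      (simp_all add: smooth_on_def)
  then show ?thesis
    using C_infinity_DERIV[of "D p u" x i] smooth_on_D[OF assms(2)] assms(3)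
    by (simp add: smooth_on_def D_eq_foldr)
qed

section \<open>Functions of jets and the chain rule\<close>

definition jet_order_le :: "(real^'n::finite) set \<Rightarrow> nat \<Rightarrow> ('n jet \<Rightarrow> real) \<Rightarrow> bool" where
  "jet_order_le X k G \<longleftrightarrow>
     (\<forall>x\<in>X. \<forall>\<xi> \<eta>. (\<forall>p. mi_order p \<le> k \<longrightarrow> \<xi> p = \<eta> p) \<longrightarrow> G (x, \<xi>) = G (x, \<eta>))"

lemma jet_order_leD:
  "jet_order_le X k G \<Longrightarrow> x \<in> X \<Longrightarrow> (\<And>p. mi_order p \<le> k \<Longrightarrow> \<xi> p = \<eta> p) \<Longrightarrow> G (x, \<xi>) = G (x, \<eta>)"
  by (auto simp: jet_order_le_def)

lemma partial_deriv_jet_eq: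
  assumes X: "open X" "x \<in> X" and G: "jet_order_le X k G"
    and eq: "\<And>p. mi_order p \<le> k \<Longrightarrow> \<xi> p = \<eta> p"
  shows "partial_deriv mv_jet d G (x, \<xi>) = partial_deriv mv_jet d G (x, \<eta>)"
proof -
  interpret partial_flow mv_x X using X(1) by (rule partial_flow_mv_x)
  have "eventually (\<lambda>t. G (mv_jet d t (x, \<xi>)) = G (mv_jet d t (x, \<eta>))) (nhds 0)"
  proof (cases d)
    case (Inl i)
    show ?thesis
      using eventually_mv_in_domain[OF X(2), of i]
      by (rule eventually_mono) (use eq in \<open>auto simp: Inl intro!: jet_order_leD[OF G]\<close>)
  next
    case (Inr p)
    then show ?thesis
      using eq by (auto intro!: always_eventually jet_order_leD[OF G X(2)])
  qed
  then show ?thesis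
    unfolding partial_deriv_def deriv_def by (simp add: DERIV_cong_ev[OF refl _ refl])
qed

lemma jet_order_le_partial_deriv:
  "open X \<Longrightarrow> jet_order_le X k G \<Longrightarrow> jet_order_le X k (partial_deriv mv_jet d G)"
  unfolding jet_order_le_def[where G = "partial_deriv mv_jet d G"]
  by (blast intro: partial_deriv_jet_eq)

lemma jet_fun_constant_beyond_order:
  assumes "jet_order_le X k G" "x \<in> X" "k < mi_order p"
  shows "G (mv_jet (Inr p) t (x, \<xi>)) = G (x, \<xi>)"
  using assms by (auto intro!: jet_order_leD)

lemma partial_deriv_beyond_order:
  assumes "jet_order_le X k G" "x \<in> X" "k < mi_order p"
  shows "partial_deriv mv_jet (Inr p) G (x, \<xi>) = 0"
  unfolding partial_deriv_def
  by (subst jet_fun_constant_beyond_order[OF assms]) (auto intro!: DERIV_imp_deriv derivative_eq_intros)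

text \<open>
  Along \<open>\<xi>\<^sub>p\<close> with \<open>|p| > k\<close> a function of order \<open>k\<close> is constant, so smoothness in the finitely many
  relevant variables is smoothness in all of them.  This frees the calculus of jets from
  bookkeeping about the set of directions, which grows with every total derivative.
\<close>

lemma smooth_jet_fun_C_upto:
  assumes X: "open X" and G: "smooth_jet_fun X k G"
  shows "C_upto mv_jet (X \<times> UNIV) j G"
  using G
proof (induction j arbitrary: G)
  case 0
  then show ?case using C_infinity_continuous by (auto simp: smooth_jet_fun_def)
next
  case (Suc j)
  interpret partial_flow mv_jet "X \<times> UNIV" using X by (rule partial_flow_mv_jet)
  let ?A = "range Inl \<union> Inr ` {p. mi_order p \<le> k}"
  have order: "jet_order_le X k G" and smooth: "C_infinity mv_jet ?A (X \<times> UNIV) G"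
    using Suc.prems by (auto simp: smooth_jet_fun_def jet_order_le_def)
  have "(\<forall>a\<in>X \<times> UNIV. (\<lambda>t. G (mv_jet d t a)) differentiable (at 0)) \<and>
      C_upto mv_jet (X \<times> UNIV) j (partial_deriv mv_jet d G)" for d
  proof (cases "d \<in> ?A")
    case True
    then have "smooth_jet_fun X k (partial_deriv mv_jet d G)"
      using C_infinity_partial_deriv[OF smooth True] jet_order_le_partial_deriv[OF X order, of d]
      by (simp add: smooth_jet_fun_def jet_order_le_def)
    then show ?thesis
      using Suc.IH C_infinity_differentiable[OF smooth True] by blast
  next
    case False
    obtain p where p: "d = Inr p" "k < mi_order p"
    proof (cases d)
      case (Inr p)
      then show ?thesis using False that[of p] by (auto simp: image_iff)
    qed (use False in simp)
    have "C_upto mv_jet (X \<times> UNIV) j (partial_deriv mv_jet d G)"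
      by (rule C_upto_cong[OF C_upto_zero]) (auto simp: p partial_deriv_beyond_order[OF order])
    moreover have "(\<lambda>t. G (mv_jet d t a)) differentiable (at 0)" if "a \<in> X \<times> UNIV" for a
      using that jet_fun_constant_beyond_order[OF order _ p(2)]
      by (auto simp: p(1) simp del: mv_jet.simps)
    ultimately show ?thesis by blast
  qed
  then show ?case
    using C_infinity_continuous[OF smooth] by simp
qed

lemma smooth_jet_fun_iff:
  assumes "open X"
  shows "smooth_jet_fun X k G \<longleftrightarrow> jet_order_le X k G \<and> C_infinity mv_jet UNIV (X \<times> UNIV) G"
proof
  assume "smooth_jet_fun X k G"
  then show "jet_order_le X k G \<and> C_infinity mv_jet UNIV (X \<times> UNIV) G"
    using smooth_jet_fun_C_upto[OF assms]
    by (auto simp: C_infinity_iff smooth_jet_fun_def jet_order_le_def)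
next
  assume "jet_order_le X k G \<and> C_infinity mv_jet UNIV (X \<times> UNIV) G"
  then show "smooth_jet_fun X k G"
    by (simp add: smooth_jet_fun_def jet_order_le_def C_infinity_def)
qed

lemma C_infinity_jet_coordinate:
  assumes "open X"
  shows "C_infinity mv_jet UNIV (X \<times> UNIV) (\<lambda>z. snd z q)"
proof -
  interpret partial_flow mv_jet "X \<times> UNIV" using assms by (rule partial_flow_mv_jet)
  have cont: "continuous_on (X \<times> UNIV) (\<lambda>z. snd z q)"
    by (intro continuous_on_product_then_coordinatewise[where f = snd]
        continuous_on_snd continuous_on_id)
  have der: "((\<lambda>t. snd (mv_jet d t a) q) has_real_derivative (if d = Inr q then 1 else 0)) (at 0)"
    for d a
    by (cases d; cases a) (auto intro!: derivative_eq_intros)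
  have "C_upto mv_jet (X \<times> UNIV) (Suc j) (\<lambda>z. snd z q)" for j
    by (rule C_upto_SucI[OF cont der C_upto_const])
  then show ?thesis
    unfolding C_infinity_iff using C_upto_Suc_imp by blast
qed

lemma C_infinity_jet_base:
  assumes "open X" "smooth_on X f"
  shows "C_infinity mv_jet UNIV (X \<times> UNIV) (\<lambda>z. f (fst z))"
proof -
  interpret J: partial_flow mv_jet "X \<times> UNIV" using assms(1) by (rule partial_flow_mv_jet)
  interpret M: partial_flow mv_x X using assms(1) by (rule partial_flow_mv_x)
  have "C_upto mv_jet (X \<times> UNIV) j (\<lambda>z. f (fst z))" for j
    using assms(2)
  proof (induction j arbitrary: f)
    case 0
    have "continuous_on X f"
      using 0 C_infinity_continuous by (auto simp: smooth_on_def)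
    then show ?case
      by (auto intro!: continuous_on_compose2[of X f] continuous_on_fst continuous_on_id)
  next
    case (Suc j)
    have f: "C_infinity mv_x UNIV X f"
      using Suc.prems by (simp add: smooth_on_def)
    show ?case
    proof (rule J.C_upto_SucI)
      show "continuous_on (X \<times> UNIV) (\<lambda>z. f (fst z))"
        using C_infinity_continuous[OF f]
        by (auto intro!: continuous_on_compose2[of X f] continuous_on_fst continuous_on_id)
      show "((\<lambda>t. f (fst (mv_jet d t a))) has_real_derivative
          (case d of Inl i \<Rightarrow> partial_deriv mv_x i f (fst a) | Inr p \<Rightarrow> 0)) (at 0)"
        if "a \<in> X \<times> UNIV" for d :: "'a + 'a multi_index" and a
        using that M.C_infinity_DERIV[OF f] by (cases d; cases a) auto
      show "C_upto mv_jet (X \<times> UNIV) j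
          (\<lambda>a. case d of Inl i \<Rightarrow> partial_deriv mv_x i f (fst a) | Inr p \<Rightarrow> 0)"
        for d :: "'a + 'a multi_index"
        using Suc.IH C_infinity_partial_deriv[OF f] J.C_upto_zero
        by (cases d) (auto simp: smooth_on_def)
    qed
  qed
  then show ?thesis by (simp add: C_infinity_iff)
qed

lemma smooth_jet_fun_diff_base:
  assumes "open X" "smooth_jet_fun X m F" "smooth_on X f"
  shows "smooth_jet_fun X m (\<lambda>(x, \<xi>). F (x, \<xi>) - f x)"
proof -
  interpret partial_flow mv_jet "X \<times> UNIV" using assms(1) by (rule partial_flow_mv_jet)
  have "C_infinity mv_jet UNIV (X \<times> UNIV) (\<lambda>z. F z - f (fst z))"
    using assms by (intro C_infinity_diff C_infinity_jet_base) (simp_all add: smooth_jet_fun_iff)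
  moreover have "(\<lambda>z. F z - f (fst z)) = (\<lambda>(x, \<xi>). F (x, \<xi>) - f x)"
    by auto
  ultimately show ?thesis
    using assms(1,2) by (auto simp: smooth_jet_fun_iff jet_order_le_def)
qed

text \<open>
  The factor \<open>\<xi> (p + axis i 1)\<close> raises the order by one; summands with \<open>|p| > k\<close> vanish, so that the
  summation bound \<open>K\<close> does not influence the order.
\<close>

lemma smooth_jet_fun_total_deriv:
  assumes X: "open X" and G: "smooth_jet_fun X k G" 
  shows "smooth_jet_fun X (Suc k) (total_deriv K i G)"
proof -
  interpret partial_flow mv_jet "X \<times> UNIV" using X by (rule partial_flow_mv_jet)
  have order: "jet_order_le X k G" and smooth: "C_infinity mv_jet UNIV (X \<times> UNIV) G"
    using G X by (auto simp: smooth_jet_fun_iff)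
  have "total_deriv K i G = (\<lambda>z. partial_deriv mv_jet (Inl i) G z +
      (\<Sum>p | mi_order p \<le> K. partial_deriv mv_jet (Inr p) G z * snd z (p + axis i 1)))"
    by (auto simp: total_deriv_def)
  then have "C_infinity mv_jet UNIV (X \<times> UNIV) (total_deriv K i G)"
    using C_infinity_partial_deriv[OF smooth] C_infinity_jet_coordinate[OF X]
    by (auto intro!: C_infinity_add C_infinity_sum C_infinity_mult)
  moreover have "jet_order_le X (Suc k) (total_deriv K i G)"
    unfolding jet_order_le_def
  proof (intro ballI allI impI)
    fix x and \<xi> \<eta> :: "'a multi_index \<Rightarrow> real"
    assume x: "x \<in> X" and eq: "\<forall>p. mi_order p \<le> Suc k \<longrightarrow> \<xi> p = \<eta> p"
    have same: "partial_deriv mv_jet d G (x, \<xi>) = partial_deriv mv_jet d G (x, \<eta>)" for d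
      using eq by (intro partial_deriv_jet_eq[OF X x order]) simp
    have "partial_deriv mv_jet (Inr p) G (x, \<xi>) * \<xi> (p + axis i 1) =
        partial_deriv mv_jet (Inr p) G (x, \<eta>) * \<eta> (p + axis i 1)" for p
    proof (cases "mi_order p \<le> k")
      case True
      then have "mi_order (p + axis i 1) \<le> Suc k"
        by (simp only: mi_order_add_axis Suc_le_mono)
      then show ?thesis using eq same by metis
    next
      case False
      then show ?thesis by (simp add: partial_deriv_beyond_order[OF order x])
    qed
    then show "total_deriv K i G (x, \<xi>) = total_deriv K i G (x, \<eta>)"
      unfolding total_deriv_def split by (intro arg_cong2[where f = "(+)"] same sum.cong refl)
  qed
  ultimately show ?thesis
    using X by (simp add: smooth_jet_fun_iff)
qed

lemma smooth_jet_fun_foldr_total_deriv: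
  assumes "open X" "smooth_jet_fun X k G"
  shows "smooth_jet_fun X (k + length ds) (foldr (total_deriv K) ds G)"
  using assms(2) by (induction ds) (auto intro: smooth_jet_fun_total_deriv[OF assms(1)])

text \<open>
  The total derivative of \<open>G\<close> along a curve of jets.  The jet variables start to move one after the
  other: adding \<open>q\<close> to the set of moving variables adds an increment in the direction \<open>\<xi>\<^sub>q\<close> along the
  curve obtained so far, to which \<open>DERIV_increment\<close> applies.  Thus no norm on jets is needed.
\<close>

lemma DERIV_jet_curve:
  assumes X: "open X" "x \<in> X" and G: "C_infinity mv_jet UNIV (X \<times> UNIV) G"
    and c: "\<And>p. ((\<lambda>t. c t p) has_real_derivative c' p) (at 0)" and P: "finite P"
  shows "((\<lambda>t. G (mv_x i t x, \<lambda>p. if p \<in> P then c t p else c 0 p)) has_real_derivative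
    partial_deriv mv_jet (Inl i) G (x, c 0) +
    (\<Sum>p\<in>P. partial_deriv mv_jet (Inr p) G (x, c 0) * c' p)) (at 0)"
  using P
proof induction
  interpret partial_flow mv_jet "X \<times> UNIV" using X(1) by (rule partial_flow_mv_jet)
  case empty
  show ?case
    using C_infinity_DERIV[OF G, of "(x, c 0)" "Inl i"] X(2) by simp
next
  case (insert q P)
  interpret partial_flow mv_jet "X \<times> UNIV" using X(1) by (rule partial_flow_mv_jet)
  define z where "z t = (mv_x i t x, \<lambda>p. if p \<in> P then c t p else c 0 p)" for t
  have z0: "z 0 = (x, c 0)"
    by (auto simp: z_def mv_x_def)
  have "isCont z 0"
    unfolding isCont_def
  proof -
    have "((\<lambda>t. mv_x i t x) \<longlongrightarrow> mv_x i 0 x) (at 0)"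
      unfolding mv_x_def by (intro tendsto_intros)
    moreover have "((\<lambda>t. if p \<in> P then c t p else c 0 p) \<longlongrightarrow> c 0 p) (at 0)" for p
      using DERIV_isCont[OF c[of p]] by (cases "p \<in> P") (simp_all add: isCont_def)
    then have "((\<lambda>t p. if p \<in> P then c t p else c 0 p) \<longlongrightarrow> c 0) (at 0)"
      using limitin_componentwise[of "\<lambda>_. euclidean" UNIV "\<lambda>t p. if p \<in> P then c t p else c 0 p"
          "c 0" "at 0", unfolded euclidean_product_topology limitin_canonical_iff]
      by simp
    ultimately have "((\<lambda>t. (mv_x i t x, \<lambda>p. if p \<in> P then c t p else c 0 p)) \<longlongrightarrow> (mv_x i 0 x, c 0)) (at 0)"
      by (rule tendsto_Pair)
    then show "(z \<longlongrightarrow> z 0) (at 0)"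
      by (simp add: z0 z_def[abs_def] mv_x_def)
  qed
  moreover have "((\<lambda>t. c t q - c 0 q) has_real_derivative c' q) (at 0)"
    using DERIV_diff[OF c DERIV_const] by simp
  ultimately have "((\<lambda>t. G (mv_jet (Inr q) (c t q - c 0 q) (z t)) - G (z t)) has_real_derivative
      partial_deriv mv_jet (Inr q) G (z 0) * c' q) (at 0)"
    by (intro DERIV_increment[OF G]) (simp_all add: z0 X)
  from DERIV_add[OF insert.IH this[unfolded z0]]
  have "((\<lambda>t. G (mv_jet (Inr q) (c t q - c 0 q) (z t))) has_real_derivative
      partial_deriv mv_jet (Inl i) G (x, c 0) +
      (\<Sum>p\<in>P. partial_deriv mv_jet (Inr p) G (x, c 0) * c' p) +
      partial_deriv mv_jet (Inr q) G (x, c 0) * c' q) (at 0)"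
    by (simp add: z_def del: mv_jet.simps)
  moreover have "mv_jet (Inr q) (c t q - c 0 q) (z t) =
      (mv_x i t x, \<lambda>p. if p \<in> insert q P then c t p else c 0 p)" for t
    using insert.hyps(2) by (auto simp: z_def fun_eq_iff)
  ultimately show ?case
    using insert.hyps by (simp add: algebra_simps)
qed

lemma DERIV_pde_op:
  assumes X: "open X" "x \<in> X" and G: "smooth_jet_fun X k G" "k \<le> K" and u: "smooth_on X u"
  shows "((\<lambda>t. pde_op G u (mv_x i t x)) has_real_derivative pde_op (total_deriv K i G) u x) (at 0)"
proof -
  interpret partial_flow mv_x X using X(1) by (rule partial_flow_mv_x)
  have smooth: "C_infinity mv_jet UNIV (X \<times> UNIV) G" and order: "jet_order_le X k G"
    using G(1) X(1) by (auto simp: smooth_jet_fun_iff)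
  let ?P = "{p :: 'a multi_index. mi_order p \<le> K}"
  let ?c = "\<lambda>t p. D p u (mv_x i t x)"
  have "eventually (\<lambda>t. G (mv_x i t x, \<lambda>p. if p \<in> ?P then ?c t p else ?c 0 p) =
      pde_op G u (mv_x i t x)) (nhds 0)"
    using eventually_mv_in_domain[OF X(2), of i]
    by (rule eventually_mono) (use G(2) in \<open>auto simp: pde_op_def intro!: jet_order_leD[OF order]\<close>)
  moreover have "((\<lambda>t. G (mv_x i t x, \<lambda>p. if p \<in> ?P then ?c t p else ?c 0 p)) has_real_derivative
      partial_deriv mv_jet (Inl i) G (x, ?c 0) +
      (\<Sum>p\<in>?P. partial_deriv mv_jet (Inr p) G (x, ?c 0) * D (p + axis i 1) u x)) (at 0)"
    by (rule DERIV_jet_curve[OF X smooth DERIV_D[OF X(1) u X(2)] finite_mi_order_le])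
  ultimately have "((\<lambda>t. pde_op G u (mv_x i t x)) has_real_derivative
      partial_deriv mv_jet (Inl i) G (x, ?c 0) +
      (\<Sum>p\<in>?P. partial_deriv mv_jet (Inr p) G (x, ?c 0) * D (p + axis i 1) u x)) (at 0)"
    by (simp only: DERIV_cong_ev[OF refl _ refl])
  then show ?thesis
    by (simp add: pde_op_def total_deriv_def)
qed

lemma smooth_on_pde_op:
  assumes X: "open X" and G: "smooth_jet_fun X k G" and u: "smooth_on X u"
  shows "smooth_on X (pde_op G u)"
proof -
  interpret partial_flow mv_x X using X by (rule partial_flow_mv_x)
  have cont: "continuous_on X (pde_op G u)" if "smooth_jet_fun X k G" for k G
  proof -
    have "continuous_on X (\<lambda>x. D p u x)" for p
      using smooth_on_D[OF u, of p] unfolding smooth_on_def by (rule C_infinity_continuous)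
    then have jet: "continuous_on X (\<lambda>x. (x, \<lambda>p. D p u x))"
      by (intro continuous_on_Pair continuous_on_id continuous_on_coordinatewise_then_product)
    have "continuous_on (X \<times> UNIV) G"
      using that C_infinity_continuous by (auto simp: smooth_jet_fun_def)
    from continuous_on_compose2[OF this jet] show ?thesis
      by (force simp: pde_op_def[abs_def])
  qed
  have "C_upto mv_x X j (pde_op G u)" for j
    using G
  proof (induction j arbitrary: k G)
    case (Suc j)
    show ?case
    proof (rule C_upto_SucI)
      show "C_upto mv_x X j (pde_op (total_deriv k i G) u)" for i
        by (rule Suc.IH[OF smooth_jet_fun_total_deriv[OF X Suc.prems]])
    qed (use cont[OF Suc.prems] DERIV_pde_op[OF X _ Suc.prems order_refl u] in auto)
  qed (simp add: cont)
  then show ?thesis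
    by (simp add: smooth_on_def C_infinity_iff)
qed

lemma foldr_partial_deriv_pde_op:
  assumes X: "open X" "x \<in> X" and G: "smooth_jet_fun X k G" "k + length ds \<le> K" and u: "smooth_on X u"
  shows "foldr (partial_deriv mv_x) ds (pde_op G u) x = pde_op (foldr (total_deriv K) ds G) u x"
  using X(2) G(2)
proof (induction ds arbitrary: x)
  case (Cons d ds)
  interpret partial_flow mv_x X using X(1) by (rule partial_flow_mv_x)
  have "partial_deriv mv_x d (foldr (partial_deriv mv_x) ds (pde_op G u)) x =
      partial_deriv mv_x d (pde_op (foldr (total_deriv K) ds G) u) x"
    using Cons by (intro partial_deriv_cong) auto
  also have "\<dots> = pde_op (total_deriv K d (foldr (total_deriv K) ds G)) u x"
    using Cons.prems
    by (intro partial_deriv_unique DERIV_pde_op[OF X(1) _ smooth_jet_fun_foldr_total_deriv[OF X(1) G(1)] _ u]) auto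
  finally show ?case by simp
qed simp

text \<open>
  This identifies the formal expression inside \<open>F_l\<close> with a derivative of an actual function: if
  \<open>G (x, \<xi>) = F (x, \<xi>) - f x\<close>, the right-hand side is the expression whose square occurs in \<open>F_l\<close>,
  evaluated at the jet of \<open>u\<close> at \<open>x\<close>.
\<close>

lemma D_pde_op:
  assumes "open X" "x \<in> X" "smooth_jet_fun X k G" "k + mi_order p \<le> K" "smooth_on X u"
  shows "D p (pde_op G u) x = multi_power (total_deriv K) p G (x, \<lambda>q. D q u x)"
  using foldr_partial_deriv_pde_op[of X x k G "mi_word p" K u] assms
  by (simp add: D_eq_foldr multi_power_eq_foldr length_mi_word pde_op_def)

section \<open>Functions vanishing to finite order and flat cutoffs\<close>

interpretation space: partial_flow mv_x UNIV
  by (rule partial_flow_mv_x) simp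

lemma smooth_on_subset: "smooth_on UNIV u \<Longrightarrow> smooth_on X u"
  unfolding smooth_on_def C_infinity_def by (blast intro: continuous_on_subset)

lemma smooth_on_component: "smooth_on UNIV (\<lambda>x. x $ i)"
proof -
  have "C_upto mv_x UNIV (Suc k) (\<lambda>x. x $ i)" for k
    by (rule space.C_upto_SucI[where g' = "\<lambda>j _. axis j 1 $ i", OF _ _ space.C_upto_const])
      (auto simp: mv_x_def intro!: continuous_intros derivative_eq_intros)
  then show ?thesis
    unfolding smooth_on_def C_infinity_iff using space.C_upto_Suc_imp by blast
qed

text \<open>
  The recursion on first derivatives makes it immediate from the product rule that these functions
  form an ideal, without a Leibniz formula for higher derivatives.
\<close>

fun vanishes_to_order :: "nat \<Rightarrow> (real^'n::finite \<Rightarrow> real) \<Rightarrow> real^'n \<Rightarrow> bool" where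
  "vanishes_to_order 0 u a \<longleftrightarrow> u a = 0"
| "vanishes_to_order (Suc N) u a \<longleftrightarrow>
     u a = 0 \<and> (\<forall>i. vanishes_to_order N (partial_deriv mv_x i u) a)"

lemma vanishes_to_order_value: "vanishes_to_order N u a \<Longrightarrow> u a = 0"
  by (cases N) auto

lemma vanishes_to_order_foldr:
  "vanishes_to_order N u a \<Longrightarrow> length ds \<le> N \<Longrightarrow> foldr (partial_deriv mv_x) ds u a = 0"
proof (induction ds arbitrary: N u rule: rev_induct)
  case (snoc d ds)
  then show ?case by (cases N) auto
qed (simp add: vanishes_to_order_value)

lemma vanishes_to_order_Suc_imp: "vanishes_to_order (Suc N) u a \<Longrightarrow> vanishes_to_order N u a"
  by (induction N arbitrary: u) auto

lemma smooth_on_UNIV_partial_deriv: "smooth_on UNIV u \<Longrightarrow> smooth_on UNIV (partial_deriv mv_x i u)"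
  by (simp add: smooth_on_def C_infinity_partial_deriv)

lemma partial_deriv_add_UNIV:
  "smooth_on UNIV u \<Longrightarrow> smooth_on UNIV v \<Longrightarrow>
    partial_deriv mv_x i (\<lambda>x. u x + v x) = (\<lambda>x. partial_deriv mv_x i u x + partial_deriv mv_x i v x)"
  by (auto simp: smooth_on_def space.partial_deriv_add)

lemma partial_deriv_mult_UNIV:
  "smooth_on UNIV u \<Longrightarrow> smooth_on UNIV v \<Longrightarrow>
    partial_deriv mv_x i (\<lambda>x. u x * v x) =
      (\<lambda>x. partial_deriv mv_x i u x * v x + u x * partial_deriv mv_x i v x)"
  by (auto simp: smooth_on_def space.partial_deriv_mult)

lemma smooth_on_UNIV_mult:
  "smooth_on UNIV u \<Longrightarrow> smooth_on UNIV v \<Longrightarrow> smooth_on UNIV (\<lambda>x. u x * v x)"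
  by (simp add: smooth_on_def space.C_infinity_mult)

lemma vanishes_to_order_add:
  "smooth_on UNIV u \<Longrightarrow> smooth_on UNIV v \<Longrightarrow> vanishes_to_order N u a \<Longrightarrow> vanishes_to_order N v a \<Longrightarrow>
    vanishes_to_order N (\<lambda>x. u x + v x) a"
  by (induction N arbitrary: u v) (simp_all add: partial_deriv_add_UNIV smooth_on_UNIV_partial_deriv)

lemma vanishes_to_order_zero: "vanishes_to_order N (\<lambda>_. 0) a"
proof (induction N)
  case (Suc N)
  have "partial_deriv mv_x i (\<lambda>_. 0) = (\<lambda>_. 0)" for i :: 'a
    by (auto intro!: space.partial_deriv_unique)
  then show ?case using Suc by simp
qed simp

lemma vanishes_to_order_sum:
  assumes "\<And>j. j \<in> I \<Longrightarrow> smooth_on UNIV (u j)" "\<And>j. j \<in> I \<Longrightarrow> vanishes_to_order N (u j) a"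
  shows "vanishes_to_order N (\<lambda>x. \<Sum>j\<in>I. u j x) a"
  using assms
proof (induction I rule: infinite_finite_induct)
  case (insert j I)
  then have "smooth_on UNIV (\<lambda>x. \<Sum>j\<in>I. u j x)"
    by (auto simp: smooth_on_def intro!: space.C_infinity_sum)
  with insert show ?case by (simp add: vanishes_to_order_add)
qed (simp_all add: vanishes_to_order_zero)

lemma vanishes_to_order_mult:
  assumes "smooth_on UNIV u" "smooth_on UNIV v" "vanishes_to_order N u a"
  shows "vanishes_to_order N (\<lambda>x. u x * v x) a"
  using assms
proof (induction N arbitrary: u v)
  case (Suc N)
  have "vanishes_to_order N (\<lambda>x. partial_deriv mv_x i u x * v x + u x * partial_deriv mv_x i v x) a" for i
    using Suc.prems vanishes_to_order_Suc_imp[OF Suc.prems(3)]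
    by (intro vanishes_to_order_add Suc.IH smooth_on_UNIV_mult smooth_on_UNIV_partial_deriv) auto
  then show ?case
    using Suc.prems by (simp add: partial_deriv_mult_UNIV)
qed simp

text \<open>
  Each factor that vanishes at \<open>a\<close> adds one to the order of vanishing; powers of such a factor
  therefore vanish to any prescribed order.
\<close>

lemma vanishes_to_order_Suc_mult:
  assumes "smooth_on UNIV u" "smooth_on UNIV v" "u a = 0" "vanishes_to_order N v a"
  shows "vanishes_to_order (Suc N) (\<lambda>x. u x * v x) a"
  using assms
proof (induction N arbitrary: v)
  case 0
  then show ?case by (simp add: partial_deriv_mult_UNIV)
next
  case (Suc N)
  have "vanishes_to_order (Suc N) (\<lambda>x. partial_deriv mv_x i u x * v x) a" for i
    using vanishes_to_order_mult[OF Suc.prems(2) smooth_on_UNIV_partial_deriv[OF Suc.prems(1), of i] Suc.prems(4)]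
    by (simp add: mult.commute)
  moreover have "vanishes_to_order (Suc N) (\<lambda>x. u x * partial_deriv mv_x i v x) a" for i
    using Suc.prems by (intro Suc.IH smooth_on_UNIV_partial_deriv) auto
  ultimately have "vanishes_to_order (Suc N)
      (\<lambda>x. partial_deriv mv_x i u x * v x + u x * partial_deriv mv_x i v x) a" for i
    using Suc.prems(1,2)
    by (intro vanishes_to_order_add smooth_on_UNIV_mult smooth_on_UNIV_partial_deriv)
  then have "vanishes_to_order (Suc N) (partial_deriv mv_x i (\<lambda>x. u x * v x)) a" for i
    by (simp only: partial_deriv_mult_UNIV[OF Suc.prems(1,2)])
  then show ?case
    using Suc.prems(3) by (subst vanishes_to_order.simps) simp
qed

lemma vanishes_to_order_power:
  assumes "smooth_on UNIV u" "u a = 0"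
  shows "vanishes_to_order N (\<lambda>x. u x ^ Suc N) a"
proof (induction N)
  case 0
  show ?case using assms by simp
next
  case (Suc N)
  have "smooth_on UNIV (\<lambda>x. u x ^ Suc N)"
    using assms(1) unfolding smooth_on_def by (rule space.C_infinity_power)
  from vanishes_to_order_Suc_mult[OF assms(1) this assms(2) Suc]
  show ?case by simp
qed

text \<open>
  Polynomials replace bump functions, as only finitely many points matter.  If \<open>h\<close> is \<open>1\<close> at \<open>a\<close> and
  \<open>0\<close> at the other points, then \<open>y = h\<^bsup>N+1\<^esup>\<close> vanishes to order \<open>N\<close> at the others, and
  \<open>e = 1 - (1 - y)\<^bsup>N+1\<^esup>\<close> is a multiple of \<open>y\<close>, while \<open>1 - e\<close> is an \<open>(N+1)\<close>-st power of a function
  vanishing at \<open>a\<close>.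
\<close>

lemma ex_flat_cutoff:
  fixes A :: "(real^'n::finite) set"
  assumes "finite A"
  obtains e where "smooth_on UNIV e" "vanishes_to_order N (\<lambda>x. e x - 1) a"
    "\<And>b. b \<in> A \<Longrightarrow> b \<noteq> a \<Longrightarrow> vanishes_to_order N e b"
proof
  \<comment> \<open>A coordinate in which \<open>a\<close> and \<open>b\<close> differ.\<close>
  define i where "i b = (SOME i. a $ i \<noteq> b $ i)" for b
  have i: "a $ i b \<noteq> b $ i b" if "b \<noteq> a" for b
  proof -
    from that obtain j where "a $ j \<noteq> b $ j" by (metis vec_eq_iff)
    then show ?thesis unfolding i_def by (rule someI)
  qed
  define h where "h x = (\<Prod>b\<in>A - {a}. (x $ i b - b $ i b) * (1 / (a $ i b - b $ i b)))" for x
  have smooth_h: "smooth_on UNIV h"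
    unfolding smooth_on_def h_def[abs_def] using smooth_on_component
    by (intro space.C_infinity_prod space.C_infinity_mult space.C_infinity_diff space.C_infinity_const)
      (auto simp: smooth_on_def)
  have "h a = 1"
    unfolding h_def by (intro prod.neutral) (use i in auto)
  have h_b: "h b = 0" if "b \<in> A" "b \<noteq> a" for b
    unfolding h_def using that assms by (intro prod_zero) auto
  let ?y = "\<lambda>x. h x ^ Suc N"
  let ?e = "\<lambda>x. 1 - (1 - ?y x) ^ Suc N"
  have smooth_y: "smooth_on UNIV (\<lambda>x. 1 - ?y x)" "smooth_on UNIV ?y"
    using smooth_h unfolding smooth_on_def
    by (intro space.C_infinity_diff space.C_infinity_const space.C_infinity_power; assumption)+
  then have smooth_pow: "smooth_on UNIV (\<lambda>x. (1 - ?y x) ^ j)" for j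
    unfolding smooth_on_def by (intro space.C_infinity_power)
  then show "smooth_on UNIV ?e"
    unfolding smooth_on_def by (intro space.C_infinity_diff space.C_infinity_const)
  have const: "smooth_on UNIV (\<lambda>_ :: real^'n. - 1)"
    by (simp add: smooth_on_def space.C_infinity_const)
  have "vanishes_to_order N (\<lambda>x. (1 - ?y x) ^ Suc N) a"
    using smooth_y(1) \<open>h a = 1\<close> by (intro vanishes_to_order_power) auto
  from vanishes_to_order_mult[OF smooth_pow const this]
  show "vanishes_to_order N (\<lambda>x. ?e x - 1) a"
    by (simp only: mult_minus1_right diff_diff_eq2 diff_0 minus_diff_eq) simp
  show "vanishes_to_order N ?e b" if b: "b \<in> A" "b \<noteq> a" for b
  proof -
    have "vanishes_to_order N (\<lambda>x. ?y x * (\<Sum>j<Suc N. (1 - ?y x) ^ j)) b"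
      using h_b[OF b] smooth_h smooth_y(2) smooth_pow
      by (intro vanishes_to_order_mult vanishes_to_order_power)
        (auto simp only: smooth_on_def intro!: space.C_infinity_sum)
    moreover have "?e x = ?y x * (\<Sum>j<Suc N. (1 - ?y x) ^ j)" for x
      using one_diff_power_eq[of "1 - ?y x" "Suc N"] by simp
    ultimately show ?thesis by presburger
  qed
qed

section \<open>Interpolation of jets\<close>

definition taylor_monomial :: "real^'n::finite \<Rightarrow> 'n multi_index \<Rightarrow> real^'n \<Rightarrow> real" where
  "taylor_monomial a p x = (\<Prod>i\<in>UNIV. (x $ i - a $ i) ^ (p $ i) / fact (p $ i))"

text \<open>
  Summing over the support of \<open>c\<close> instead of over a fixed range of degrees lets a partial derivative
  act as an exact index shift on \<open>c\<close>, without boundary terms.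
\<close>

definition taylor_poly :: "real^'n::finite \<Rightarrow> ('n multi_index \<Rightarrow> real) \<Rightarrow> real^'n \<Rightarrow> real" where
  "taylor_poly a c x = (\<Sum>p | c p \<noteq> 0. c p * taylor_monomial a p x)"

lemma DERIV_taylor_monomial:
  "((\<lambda>t. taylor_monomial a p (mv_x i t x)) has_real_derivative
    (if p $ i = 0 then 0 else taylor_monomial a (p - axis i 1) x)) (at 0)"
proof -
  let ?R = "\<Prod>j\<in>UNIV - {i}. (x $ j - a $ j) ^ (p $ j) / fact (p $ j)"
  have split: "taylor_monomial a q y =
      (y $ i - a $ i) ^ (q $ i) / fact (q $ i) * (\<Prod>j\<in>UNIV - {i}. (y $ j - a $ j) ^ (q $ j) / fact (q $ j))"
    for q y
    unfolding taylor_monomial_def by (rule prod.remove) auto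
  have "taylor_monomial a p (mv_x i t x) = (x $ i + t - a $ i) ^ (p $ i) / fact (p $ i) * ?R" for t
    by (subst split) (auto simp: mv_x_def axis_def intro!: prod.cong)
  moreover have "((\<lambda>t. (x $ i + t - a $ i) ^ (p $ i) / fact (p $ i) * ?R) has_real_derivative
      p $ i * (x $ i - a $ i) ^ (p $ i - 1) / fact (p $ i) * ?R) (at 0)"
    by (auto intro!: derivative_eq_intros)
  moreover have "p $ i * (x $ i - a $ i) ^ (p $ i - 1) / fact (p $ i) * ?R =
      (if p $ i = 0 then 0 else taylor_monomial a (p - axis i 1) x)"
  proof (cases "p $ i")
    case (Suc k)
    have "taylor_monomial a (p - axis i 1) x = (x $ i - a $ i) ^ k / fact k * ?R"
      by (subst split) (auto simp: Suc axis_def intro!: prod.cong)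
    moreover have "real (Suc k) / fact (Suc k) = 1 / fact k"
      by (simp add: field_simps del: of_nat_Suc)
    ultimately show ?thesis
      by (simp add: Suc del: of_nat_Suc fact_Suc)
        (metis (no_types, lifting) mult.commute mult.left_neutral times_divide_eq_left times_divide_eq_right)
  qed simp
  ultimately show ?thesis by simp
qed

lemma finite_support_shift:
  fixes c :: "'n::finite multi_index \<Rightarrow> real"
  assumes "finite {p. c p \<noteq> 0}"
  shows "finite {p. c (p + q) \<noteq> 0}"
  using finite_vimageI[OF assms, of "\<lambda>p. p + q"] by (simp add: vimage_def inj_on_def)

lemma DERIV_taylor_poly:
  assumes "finite {p. c p \<noteq> 0}"
  shows "((\<lambda>t. taylor_poly a c (mv_x i t x)) has_real_derivative
    taylor_poly a (\<lambda>p. c (p + axis i 1)) x) (at 0)"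
proof -
  let ?m = "\<lambda>p. taylor_monomial a (p - axis i 1) x"
  have "((\<lambda>t. taylor_poly a c (mv_x i t x)) has_real_derivative
      (\<Sum>p | c p \<noteq> 0. c p * (if p $ i = 0 then 0 else ?m p))) (at 0)"
    unfolding taylor_poly_def by (intro DERIV_sum DERIV_cmult DERIV_taylor_monomial)
  also have "(\<Sum>p | c p \<noteq> 0. c p * (if p $ i = 0 then 0 else ?m p)) =
      (\<Sum>p | c p \<noteq> 0 \<and> p $ i \<noteq> 0. c p * ?m p)"
    using assms by (intro sum.mono_neutral_cong_right) auto
  also have "\<dots> = taylor_poly a (\<lambda>p. c (p + axis i 1)) x"
    unfolding taylor_poly_def
  proof (rule sum.reindex_bij_witness[where i = "\<lambda>q. q + axis i 1" and j = "\<lambda>p. p - axis i 1"])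
    fix p :: "'a multi_index" assume p: "p \<in> {p. c p \<noteq> 0 \<and> p $ i \<noteq> 0}"
    then show "p - axis i 1 + axis i 1 = p"
      by (auto simp: vec_eq_iff axis_def)
    with p show "p - axis i 1 \<in> {p. c (p + axis i 1) \<noteq> 0}"
      "c (p - axis i 1 + axis i 1) * taylor_monomial a (p - axis i 1) x = c p * ?m p"
      by auto
  qed (auto simp: axis_def)
  finally show ?thesis .
qed

lemma partial_deriv_taylor_poly:
  "finite {p. c p \<noteq> 0} \<Longrightarrow>
    partial_deriv mv_x i (taylor_poly a c) = taylor_poly a (\<lambda>p. c (p + axis i 1))"
  by (intro ext space.partial_deriv_unique DERIV_taylor_poly)

lemma smooth_on_taylor_poly:
  assumes "finite {p. c p \<noteq> 0}"
  shows "smooth_on UNIV (taylor_poly a c)"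
proof -
  have "continuous_on UNIV (taylor_poly a c)" for c :: "'a multi_index \<Rightarrow> real"
    unfolding taylor_poly_def taylor_monomial_def by (intro continuous_intros) auto
  then have "C_upto mv_x UNIV k (taylor_poly a c)" for k
    using assms
  proof (induction k arbitrary: c)
    case (Suc k)
    show ?case
      by (rule space.C_upto_SucI[OF Suc.prems(1) DERIV_taylor_poly[OF Suc.prems(2)]])
        (rule Suc.IH[OF Suc.prems(1) finite_support_shift[OF Suc.prems(2)]])
  qed simp
  then show ?thesis by (simp add: smooth_on_def C_infinity_iff)
qed

lemma taylor_poly_at_centre:
  assumes "finite {p. c p \<noteq> 0}"
  shows "taylor_poly a c a = c 0"
proof -
  have "taylor_monomial a p a = (if p = 0 then 1 else 0)" for p
    by (auto simp: taylor_monomial_def vec_eq_iff intro!: prod_zero)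
  then have "taylor_poly a c a = (\<Sum>p | c p \<noteq> 0. if p = 0 then c 0 else 0)"
    unfolding taylor_poly_def by (intro sum.cong) auto
  then show ?thesis
    using assms by (simp add: sum.delta')
qed

text \<open>
  Evaluated at the centre, where only the constant coefficient survives, the shifts read off the
  coefficients one by one: \<open>c\<close> is the jet of the polynomial at \<open>a\<close>.
\<close>

lemma foldr_partial_deriv_taylor_poly:
  assumes "finite {p. c p \<noteq> 0}"
  shows "foldr (partial_deriv mv_x) ds (taylor_poly a c) =
    taylor_poly a (\<lambda>p. c (p + (\<Sum>i\<leftarrow>ds. axis i 1)))"
proof (induction ds)
  case (Cons d ds)
  then show ?case
    using partial_deriv_taylor_poly[OF finite_support_shift[OF assms, of "\<Sum>i\<leftarrow>ds. axis i 1"], of d a]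
    by (simp add: ac_simps)
qed simp

lemma sum_list_axis_mi_word: "(\<Sum>i\<leftarrow>mi_word p. axis i 1) = p"
proof -
  have "(\<Sum>i\<leftarrow>ds. axis i (1::nat)) $ j = count (mset ds) j" for ds :: "'a list" and j
    by (induction ds) (auto simp: axis_def)
  then show ?thesis by (simp add: vec_eq_iff count_mi_word)
qed

lemma D_taylor_poly_at_centre:
  assumes "finite {p. c p \<noteq> 0}"
  shows "D q (taylor_poly a c) a = c q"
  using foldr_partial_deriv_taylor_poly[OF assms, of "mi_word q" a]
    taylor_poly_at_centre[OF finite_support_shift[OF assms]]
  by (simp add: D_eq_foldr sum_list_axis_mi_word del: One_nat_def)

text \<open>
  At a point \<open>a\<close> of \<open>A\<close>, gluing Taylor polynomials \<open>g a\<close> with flat cutoffs \<open>e a\<close> changes the function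
  \<open>g a\<close> by \<open>(e a - 1) * g a\<close> and by the terms \<open>e b * g b\<close> of the other points, all of which vanish to
  order \<open>N\<close> at \<open>a\<close>.
\<close>

lemma smooth_interpolation:
  fixes A :: "(real^'n::finite) set" and c :: "real^'n \<Rightarrow> 'n multi_index \<Rightarrow> real"
  assumes "finite A"
  shows "\<exists>s. smooth_on UNIV s \<and> (\<forall>a\<in>A. \<forall>p. mi_order p \<le> N \<longrightarrow> D p s a = c a p)"
proof -
  have "\<exists>e. smooth_on UNIV e \<and> vanishes_to_order N (\<lambda>x. e x - 1) a \<and>
      (\<forall>b\<in>A. b \<noteq> a \<longrightarrow> vanishes_to_order N e b)" for a :: "real^'n"
    using ex_flat_cutoff[OF assms, of N a] by metis
  then obtain e where e: "\<And>a. smooth_on UNIV (e a)"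
    "\<And>a. vanishes_to_order N (\<lambda>x. e a x - 1) a"
    "\<And>a b. b \<in> A \<Longrightarrow> b \<noteq> a \<Longrightarrow> vanishes_to_order N (e a) b"
    by metis
  \<comment> \<open>Truncation gives the coefficients finite support and keeps the prescribed part of the jet.\<close>
  define c' where "c' a p = (if mi_order p \<le> N then c a p else 0)" for a p
  define g where "g a = taylor_poly a (c' a)" for a
  have fin: "finite {p. c' a p \<noteq> 0}" for a
    by (rule finite_subset[OF _ finite_mi_order_le[of N]]) (auto simp: c'_def)
  then have g: "smooth_on UNIV (g a)" for a
    unfolding g_def by (rule smooth_on_taylor_poly)
  define s where "s x = (\<Sum>a\<in>A. e a x * g a x)" for x
  have "smooth_on UNIV s"
    unfolding s_def[abs_def] smooth_on_def using e(1) g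
    by (intro space.C_infinity_sum space.C_infinity_mult) (auto simp: smooth_on_def)
  moreover have "D p s a = c a p" if a: "a \<in> A" and p: "mi_order p \<le> N" for a p
  proof -
    let ?r = "\<lambda>x. (e a x - 1) * g a x + (\<Sum>b\<in>A - {a}. e b x * g b x)"
    have e1: "smooth_on UNIV (\<lambda>x. e a x - 1)"
      using e(1) unfolding smooth_on_def by (intro space.C_infinity_diff space.C_infinity_const)
    have r: "smooth_on UNIV (\<lambda>x. (e a x - 1) * g a x)"
      "smooth_on UNIV (\<lambda>x. \<Sum>b\<in>A - {a}. e b x * g b x)"
      using e1 e(1) g unfolding smooth_on_def
      by (auto intro!: space.C_infinity_mult space.C_infinity_sum)
    have "vanishes_to_order N ?r a"
      using e1 e g a
      by (intro vanishes_to_order_add vanishes_to_order_sum vanishes_to_order_mult r) 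
        (auto intro: smooth_on_UNIV_mult)
    then have "D p ?r a = 0"
      unfolding D_eq_foldr using p by (intro vanishes_to_order_foldr) (auto simp: length_mi_word)
    moreover have "s = (\<lambda>x. g a x + ?r x)"
      unfolding s_def using sum.remove[OF assms a, of "\<lambda>b. e b _ * g b _"]
      by (auto simp: algebra_simps)
    then have "D p s a = D p (g a) a + D p ?r a"
      using g r unfolding D_eq_foldr smooth_on_def
      by (simp only:) (intro space.foldr_partial_deriv_add space.C_infinity_add; simp)
    ultimately show ?thesis
      using p D_taylor_poly_at_centre[OF fin] by (simp add: g_def c'_def)
  qed
  ultimately show ?thesis by blast
qed

section \<open>Solving the equation in the quotient algebra\<close>

lemma D_add:
  assumes "open X" "x \<in> X" "smooth_on X u" "smooth_on X v"
  shows "D p (\<lambda>x. u x + v x) x = D p u x + D p v x"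
proof -
  interpret partial_flow mv_x X using assms(1) by (rule partial_flow_mv_x)
  show ?thesis
    using assms unfolding D_eq_foldr smooth_on_def by (intro foldr_partial_deriv_add)
qed

lemma D_minus:
  assumes "open X" "x \<in> X" "smooth_on X u"
  shows "D p (\<lambda>x. - u x) x = - D p u x"
proof -
  interpret partial_flow mv_x X using assms(1) by (rule partial_flow_mv_x)
  show ?thesis
    using assms unfolding D_eq_foldr smooth_on_def by (intro foldr_partial_deriv_minus)
qed

lemma J_ideal_iff:
  "w \<in> J_ideal X \<Sigma> \<longleftrightarrow> (\<forall>\<nu>. smooth_on X (w \<nu>)) \<and>
    (\<forall>x\<in>X - \<Sigma>. \<forall>l. \<exists>\<nu>. \<forall>\<mu>\<ge>\<nu>. \<forall>p. mi_order p \<le> l \<longrightarrow> D p (w \<mu>) x = 0)"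
  by (auto simp: J_ideal_def smooth_seqs_def)

lemma zero_in_J_ideal:
  assumes "open X"
  shows "(\<lambda>_ _. 0) \<in> J_ideal X \<Sigma>"
proof -
  interpret partial_flow mv_x X using assms by (rule partial_flow_mv_x)
  show ?thesis
    by (auto simp: J_ideal_iff smooth_on_def C_infinity_const D_eq_foldr foldr_partial_deriv_zero)
qed

lemma uminus_in_J_ideal:
  assumes "open X" "w \<in> J_ideal X \<Sigma>"
  shows "(\<lambda>\<nu> x. - w \<nu> x) \<in> J_ideal X \<Sigma>"
proof -
  interpret partial_flow mv_x X using assms(1) by (rule partial_flow_mv_x)
  have "smooth_on X (\<lambda>x. - w \<nu> x)" for \<nu>
    using assms(2) by (simp add: J_ideal_iff smooth_on_def C_infinity_minus)
  moreover have "D p (\<lambda>x. - w \<nu> x) x = - D p (w \<nu>) x" if "x \<in> X" for p \<nu> x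
    using assms that by (intro D_minus) (auto simp: J_ideal_iff)
  ultimately show ?thesis
    using assms(2) by (simp add: J_ideal_iff)
qed

lemma add_in_J_ideal:
  assumes X: "open X" and v: "v \<in> J_ideal X \<Sigma>" and w: "w \<in> J_ideal X \<Sigma>"
  shows "(\<lambda>\<nu> x. v \<nu> x + w \<nu> x) \<in> J_ideal X \<Sigma>"
  unfolding J_ideal_iff
proof (intro conjI allI ballI)
  interpret partial_flow mv_x X using X by (rule partial_flow_mv_x)
  show "smooth_on X (\<lambda>x. v \<nu> x + w \<nu> x)" for \<nu>
    using v w by (simp add: J_ideal_iff smooth_on_def C_infinity_add)
next
  fix x l assume x: "x \<in> X - \<Sigma>"
  obtain \<nu>1 where \<nu>1: "\<And>\<mu> p. \<nu>1 \<le> \<mu> \<Longrightarrow> mi_order p \<le> l \<Longrightarrow> D p (v \<mu>) x = 0"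
    using v x unfolding J_ideal_iff by blast
  obtain \<nu>2 where \<nu>2: "\<And>\<mu> p. \<nu>2 \<le> \<mu> \<Longrightarrow> mi_order p \<le> l \<Longrightarrow> D p (w \<mu>) x = 0"
    using w x unfolding J_ideal_iff by blast
  have "D p (\<lambda>x. v \<mu> x + w \<mu> x) x = 0" if "max \<nu>1 \<nu>2 \<le> \<mu>" "mi_order p \<le> l" for \<mu> p
    using that x v w \<nu>1 \<nu>2 X by (subst D_add[of X]) (auto simp: J_ideal_iff)
  then show "\<exists>\<nu>. \<forall>\<mu>\<ge>\<nu>. \<forall>p. mi_order p \<le> l \<longrightarrow> D p (\<lambda>x. v \<mu> x + w \<mu> x) x = 0"
    by blast
qed

lemma gen_class_eq: "gen_class X \<Sigma> s = {\<lambda>\<nu> x. h \<nu> x + s \<nu> x | h. h \<in> J_ideal X \<Sigma>}"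
  by (auto simp: gen_class_def a_r_coset_def' smooth_seqs_def)

text \<open>
  \<open>gen_class\<close> is a coset of \<open>J_ideal\<close>, so this is the usual criterion for equality of cosets; it
  rests on \<open>J_ideal\<close> being an additive subgroup.
\<close>

lemma gen_class_cong:
  assumes X: "open X" and d: "(\<lambda>\<nu> x. t \<nu> x - r \<nu> x) \<in> J_ideal X \<Sigma>"
  shows "gen_class X \<Sigma> t = gen_class X \<Sigma> r"
proof -
  have sub: "gen_class X \<Sigma> t \<subseteq> gen_class X \<Sigma> r"
    if "(\<lambda>\<nu> x. t \<nu> x - r \<nu> x) \<in> J_ideal X \<Sigma>" for t r :: "nat \<Rightarrow> real^'a \<Rightarrow> real"
  proof
    fix y assume "y \<in> gen_class X \<Sigma> t"
    then obtain h where h: "h \<in> J_ideal X \<Sigma>" "y = (\<lambda>\<nu> x. h \<nu> x + t \<nu> x)"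
      by (auto simp: gen_class_eq)
    have "(\<lambda>\<nu> x. h \<nu> x + (t \<nu> x - r \<nu> x)) \<in> J_ideal X \<Sigma>"
      by (rule add_in_J_ideal[OF X h(1) that])
    moreover have "y = (\<lambda>\<nu> x. (h \<nu> x + (t \<nu> x - r \<nu> x)) + r \<nu> x)"
      by (simp add: h(2))
    ultimately show "y \<in> gen_class X \<Sigma> r"
      unfolding gen_class_eq mem_Collect_eq by (intro exI conjI)
  qed
  have "(\<lambda>\<nu> x. r \<nu> x - t \<nu> x) \<in> J_ideal X \<Sigma>"
    using uminus_in_J_ideal[OF X d] by simp
  with sub d show ?thesis by blast
qed

lemma zero_in_R_l_iff:
  "0 \<in> R_l m F f l x \<longleftrightarrow>
    (\<exists>\<xi>. \<forall>p. mi_order p \<le> l \<longrightarrow>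
      multi_power (total_deriv (m + l)) p (\<lambda>(x, \<xi>). F (x, \<xi>) - f x) (x, \<xi>) = 0)"
  by (auto simp: R_l_def F_l_def sum_nonneg_eq_0_iff finite_mi_order_le)

text \<open>
  Suppose that from some index \<open>\<mu>\<close> on the jet of \<open>s \<mu>\<close> at \<open>x\<close> agrees up to order \<open>m + \<mu>\<close> with a jet
  \<open>\<xi>\<close> at which all total derivatives of \<open>F - f\<close> of order at most \<open>\<mu>\<close> vanish.  A term \<open>h\<close> of the ideal
  does not change the part of the jet of order at most \<open>m + l\<close> once \<open>\<mu>\<close> is large, and derivatives of
  \<open>T(x,D) u - f\<close> of order at most \<open>l\<close> see nothing else.  So the conclusion holds for every
  representative \<open>h + s\<close> of the class of \<open>s\<close>.
\<close>

lemma pde_op_diff_in_J_ideal: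
  assumes X: "open X" and F: "smooth_jet_fun X m F" and f: "smooth_on X f"
    and s: "\<And>\<nu>. smooth_on X (s \<nu>)" and h: "h \<in> J_ideal X \<Sigma>"
    and jets: "\<And>x. x \<in> X - \<Sigma> \<Longrightarrow> \<exists>\<nu>. \<forall>\<mu>\<ge>\<nu>. \<exists>\<xi>.
      (\<forall>q. mi_order q \<le> m + \<mu> \<longrightarrow> D q (s \<mu>) x = \<xi> q) \<and>
      (\<forall>p. mi_order p \<le> \<mu> \<longrightarrow>
        multi_power (total_deriv (m + \<mu>)) p (\<lambda>(x, \<xi>). F (x, \<xi>) - f x) (x, \<xi>) = 0)"
  shows "(\<lambda>\<nu> x. pde_op F (\<lambda>x. h \<nu> x + s \<nu> x) x - f x) \<in> J_ideal X \<Sigma>"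
  unfolding J_ideal_iff
proof (intro conjI allI ballI)
  interpret partial_flow mv_x X using X by (rule partial_flow_mv_x)
  let ?G = "\<lambda>(x, \<xi>). F (x, \<xi>) - f x"
  have G: "smooth_jet_fun X m ?G"
    by (rule smooth_jet_fun_diff_base[OF X F f])
  have u: "smooth_on X (\<lambda>x. h \<nu> x + s \<nu> x)" for \<nu>
    using h s by (simp add: J_ideal_iff smooth_on_def C_infinity_add)
  have eq: "(\<lambda>x. pde_op F u x - f x) = pde_op ?G u" for u
    by (simp add: pde_op_def fun_eq_iff)
  show "smooth_on X (\<lambda>x. pde_op F (\<lambda>x. h \<nu> x + s \<nu> x) x - f x)" for \<nu>
    unfolding eq by (rule smooth_on_pde_op[OF X G u])
  fix x l assume x: "x \<in> X - \<Sigma>"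
  obtain \<nu>1 where \<nu>1: "\<And>\<mu> q. \<nu>1 \<le> \<mu> \<Longrightarrow> mi_order q \<le> m + l \<Longrightarrow> D q (h \<mu>) x = 0"
    using h x unfolding J_ideal_iff by blast
  obtain \<nu>2 where \<nu>2: "\<And>\<mu>. \<nu>2 \<le> \<mu> \<Longrightarrow> \<exists>\<xi>.
      (\<forall>q. mi_order q \<le> m + \<mu> \<longrightarrow> D q (s \<mu>) x = \<xi> q) \<and>
      (\<forall>p. mi_order p \<le> \<mu> \<longrightarrow> multi_power (total_deriv (m + \<mu>)) p ?G (x, \<xi>) = 0)"
    using jets[OF x] by blast
  have "D p (pde_op ?G (\<lambda>x. h \<mu> x + s \<mu> x)) x = 0"
    if \<mu>: "\<nu>1 \<le> \<mu>" "\<nu>2 \<le> \<mu>" "l \<le> \<mu>" and p: "mi_order p \<le> l" for \<mu> p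
  proof -
    obtain \<xi> where \<xi>: "\<And>q. mi_order q \<le> m + \<mu> \<Longrightarrow> D q (s \<mu>) x = \<xi> q"
      "multi_power (total_deriv (m + \<mu>)) p ?G (x, \<xi>) = 0"
      using \<nu>2[OF \<mu>(2)] \<mu>(3) p by (meson le_trans)
    have jet: "D q (\<lambda>x. h \<mu> x + s \<mu> x) x = \<xi> q" if "mi_order q \<le> m + l" for q
      using x that \<nu>1[OF \<mu>(1)] \<xi>(1) \<mu>(3) h s X by (subst D_add[of X]) (auto simp: J_ideal_iff)
    have order: "jet_order_le X (m + mi_order p) (multi_power (total_deriv (m + \<mu>)) p ?G)"
      using smooth_jet_fun_foldr_total_deriv[OF X G, of "mi_word p" "m + \<mu>"] X
      by (simp add: multi_power_eq_foldr length_mi_word smooth_jet_fun_iff)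
    have "D p (pde_op ?G (\<lambda>x. h \<mu> x + s \<mu> x)) x =
        multi_power (total_deriv (m + \<mu>)) p ?G (x, \<lambda>q. D q (\<lambda>x. h \<mu> x + s \<mu> x) x)"
      using x \<mu> p by (intro D_pde_op[OF X _ G _ u]) auto
    also have "\<dots> = multi_power (total_deriv (m + \<mu>)) p ?G (x, \<xi>)"
      using x p jet by (intro jet_order_leD[OF order]) auto
    finally show ?thesis using \<xi>(2) by simp
  qed
  then show "\<exists>\<nu>. \<forall>\<mu>\<ge>\<nu>. \<forall>p. mi_order p \<le> l \<longrightarrow>
      D p (\<lambda>x. pde_op F (\<lambda>x. h \<mu> x + s \<mu> x) x - f x) x = 0"
    unfolding eq by (intro exI[of _ "max \<nu>1 (max \<nu>2 l)"]) simp
qed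

theorem theorem1:
  fixes X X_sol :: "(real^'n::finite) set"
    and m :: nat
    and F :: "(real^'n) \<times> ((nat^'n) \<Rightarrow> real) \<Rightarrow> real"
    and f :: "real^'n \<Rightarrow> real"
  assumes "open X" and "X \<noteq> {}"
    and "smooth_jet_fun X m F"
    and "smooth_on X f"
    and "X_sol \<subseteq> X" and "X \<subseteq> closure X_sol"
    and "\<forall>l. \<forall>x\<in>X_sol. 0 \<in> R_l m F f l x"
  shows "\<exists>\<Sigma> s U. \<Sigma> \<subseteq> X \<and> X \<subseteq> closure (X - \<Sigma>) \<and> X - \<Sigma> \<subseteq> X_sol \<and>
           s \<in> carrier (smooth_seqs X) \<and>
           U = gen_class X \<Sigma> s \<and> U \<in> carrier (B_alg X \<Sigma>) \<and>
           pde_op_B X \<Sigma> F U = const_class X \<Sigma> f"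
proof -
  \<comment> \<open>A countable dense set can be exhausted by finite sets, on which jets can be prescribed.\<close>
  obtain T where T: "countable T" "T \<subseteq> X_sol" "X_sol \<subseteq> closure T"
    using separable[of X_sol] by metis
  have "X \<subseteq> closure T"
    using assms(6) closure_mono[OF T(3)] by simp
  with assms(2) have "T \<noteq> {}" by auto
  define e where "e = from_nat_into T"
  have e: "range e = T"
    unfolding e_def using range_from_nat_into[OF \<open>T \<noteq> {}\<close> T(1)] .
  define \<Sigma> where "\<Sigma> = X - T"
  have \<Sigma>: "X - \<Sigma> = T"
    using T(2) assms(5) by (auto simp: \<Sigma>_def)
  let ?Z = "\<lambda>\<nu> x \<xi>. \<forall>p. mi_order p \<le> \<nu> \<longrightarrow>
    multi_power (total_deriv (m + \<nu>)) p (\<lambda>(x, \<xi>). F (x, \<xi>) - f x) (x, \<xi>) = 0"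
  define \<xi> where "\<xi> \<nu> x = (SOME \<xi>. ?Z \<nu> x \<xi>)" for \<nu> x
  have \<xi>: "?Z \<nu> x (\<xi> \<nu> x)" if "x \<in> T" for \<nu> x
  proof -
    have "0 \<in> R_l m F f \<nu> x"
      using assms(7) T(2) that by blast
    then have "\<exists>\<xi>. ?Z \<nu> x \<xi>"
      by (simp only: zero_in_R_l_iff)
    then show ?thesis
      unfolding \<xi>_def by (rule someI_ex)
  qed
  \<comment> \<open>The \<open>\<nu>\<close>-th function solves the equation to order \<open>\<nu>\<close> at \<open>e 0, \<dots>, e \<nu>\<close>; its jets may
    change with \<open>\<nu>\<close>, as only the vanishing of the errors matters.\<close>
  have "\<exists>s. smooth_on UNIV s \<and>
      (\<forall>x\<in>e ` {..\<nu>}. \<forall>p. mi_order p \<le> m + \<nu> \<longrightarrow> D p s x = \<xi> \<nu> x p)" for \<nu>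
    by (rule smooth_interpolation) simp
  then obtain s where s: "\<And>\<nu>. smooth_on UNIV (s \<nu>)"
    "\<And>\<nu> x p. x \<in> e ` {..\<nu>} \<Longrightarrow> mi_order p \<le> m + \<nu> \<Longrightarrow> D p (s \<nu>) x = \<xi> \<nu> x p"
    by metis
  have sX: "smooth_on X (s \<nu>)" for \<nu>
    using s(1) by (rule smooth_on_subset)
  have jets: "\<exists>\<nu>. \<forall>\<mu>\<ge>\<nu>. \<exists>\<xi>.
      (\<forall>q. mi_order q \<le> m + \<mu> \<longrightarrow> D q (s \<mu>) x = \<xi> q) \<and> ?Z \<mu> x \<xi>"
    if "x \<in> X - \<Sigma>" for x
  proof -
    from that e obtain j where j: "x = e j" by (auto simp: \<Sigma>)
    show ?thesis
    proof (intro exI[of _ j] allI impI)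
      fix \<mu> assume "j \<le> \<mu>"
      then show "\<exists>\<xi>. (\<forall>q. mi_order q \<le> m + \<mu> \<longrightarrow> D q (s \<mu>) x = \<xi> q) \<and> ?Z \<mu> x \<xi>"
        using s(2)[of x \<mu>] \<xi>[of x \<mu>] that \<Sigma> j by (intro exI[of _ "\<xi> \<mu> x"]) auto
    qed
  qed
  \<comment> \<open>The class is a solution only if every representative is sent into the class of \<open>f\<close>, because
    \<open>pde_op_B\<close> is the union over all of them.\<close>
  define U where "U = gen_class X \<Sigma> s"
  have carrier: "s \<in> carrier (smooth_seqs X)"
    using sX by (simp add: smooth_seqs_def)
  then have "U \<in> carrier (B_alg X \<Sigma>)"
    by (auto simp: U_def gen_class_def B_alg_def FactRing_def A_RCOSETS_def')
  moreover have "pde_op_B X \<Sigma> F U = const_class X \<Sigma> f"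
  proof -
    have "gen_class X \<Sigma> (\<lambda>\<nu>. pde_op F (u \<nu>)) = const_class X \<Sigma> f" if "u \<in> U" for u
      unfolding const_class_def
    proof (rule gen_class_cong[OF assms(1)])
      from that obtain h where h: "h \<in> J_ideal X \<Sigma>" "u = (\<lambda>\<nu> x. h \<nu> x + s \<nu> x)"
        by (auto simp: U_def gen_class_eq)
      show "(\<lambda>\<nu> x. pde_op F (u \<nu>) x - f x) \<in> J_ideal X \<Sigma>"
        unfolding h(2) by (rule pde_op_diff_in_J_ideal[OF assms(1,3,4) sX h(1) jets])
    qed
    moreover have "U \<noteq> {}"
      using zero_in_J_ideal[OF assms(1)] by (auto simp: U_def gen_class_eq)
    ultimately show ?thesis
      by (auto simp: pde_op_B_def)
  qed
  moreover have "\<Sigma> \<subseteq> X" by (auto simp: \<Sigma>_def)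
  ultimately show ?thesis
    using \<open>X \<subseteq> closure T\<close> T(2) carrier \<Sigma> U_def by metis
qed

end
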